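(* Let $d\ge2$, let $h$ be a needlet filter, and define the filter $H$ by $H(t)=1$ for $0\le t<1$ and $H(t)=h(t)^2$ for $t\ge1$. Let $\psi_{jk}$ ($j\ge0$, $1\le k\le N_j$) be the needlets with filter $h$ and given needlet quadrature rules. Then for every $f\in\mathbb{L}_1(\mathbb{S}^d)$ and every integer $J\ge0$, $$V_{2^{J-1},H}(f)=\sum_{j=0}^{J}\sum_{k=1}^{N_j}(f,\psi_{jk})_{\mathbb{L}_2(\mathbb{S}^d)}\,\psi_{jk}=V^{\mathrm{need}}_J(f),$$ that is, the semidiscrete needlet approximation $V^{\mathrm{need}}_J(f)$ of order $J$ (defined as the middle expression) equals the filtered approximation $V_{2^{J-1},H}(f)$.
   Context: $\mathbb{R}_+=[0,\infty)$. $\mathbb{S}^d\subset\mathbb{R}^{d+1}$ is the unit sphere with normalised surface measure $\sigma_d$ ($\sigma_d(\mathbb{S}^d)=1$); $\mathbb{L}_p(\mathbb{S}^d)$ is taken with respect to $\sigma_d$, and $(f,g)_{\mathbb{L}_2(\mathbb{S}^d)}=\int_{\mathbb{S}^d}fg\,d\sigma_d$ (whenever the integral makes sense). "Polynomial of degree up to $\nu$" means the restriction to $\mathbb{S}^d$ of a polynomial on $\mathbb{R}^{d+1}$ of total degree at most $\nu$. $Z(d,\ell)=(2\ell+d-1)\frac{\Gamma(\ell+d-1)}{\Gamma(d)\Gamma(\ell+1)}$ is the dimension of the space of spherical harmonics of exact degree $\ell$, and $P_\ell^{(d+1)}(t)=P_\ell^{(\frac{d-2}{2},\frac{d-2}{2})}(t)/P_\ell^{(\frac{d-2}{2},\frac{d-2}{2})}(1)$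 is the normalised Gegenbauer polynomial, with $P_\ell^{(\alpha,\beta)}$ the Jacobi polynomial. Needlet filter: $h:\mathbb{R}_+\to\mathbb{R}_+$ with $h\in C^\kappa(\mathbb{R}_+)$ for some integer $\kappa\ge1$, $\operatorname{supp}h=[1/2,2]$, and $h(t)^2+h(2t)^2=1$ for $t\in[1/2,1]$. Filtered kernel with filter $g$ (continuous, $\mathbb{R}_+\to\mathbb{R}_+$, support in $[0,2]$): $v_{T,g}(\mathbf{x}\cdot\mathbf{y})=1$ if $0\le T<1$, and $v_{T,g}(\mathbf{x}\cdot\mathbf{y})=\sum_{\ell=0}^\infty g(\ell/T)Z(d,\ell)P_\ell^{(d+1)}(\mathbf{x}\cdot\mathbf{y})$ if $T\ge1$. Filtered approximation: $V_{T,g}(f;\mathbf{x})=\int_{\mathbb{S}^d}f(\mathbf{y})\,v_{T,g}(\mathbf{x}\cdot\mathbf{y})\,d\sigma_d(\mathbf{y})$ for $f\in\mathbb{L}_1(\mathbb{S}^d)$. Needlets: for each $j\ge0$, the needlet quadrature $\{(w_{jk},\mathbf{x}_{jk}):k=1,\dots,N_j\}$, with $w_{jk}>0$ and $\mathbf{x}_{jk}\in\mathbb{S}^d$, satisfies $\int_{\mathbb{S}^d}q\,d\sigma_d=\sum_{k}w_{jk}q(\mathbf{x}_{jk})$ for all polynomials $q$ of degree up to $2^{j+1}-1$, and $\psi_{jk}(\mathbf{x}):=\sqrt{w_{jk}}\,v_{2^{j-1},h}(\mathbf{x}\cdot\mathbf{x}_{jk})$. *)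

theory Defs
  imports "HOL-Analysis.Analysis"
begin

text \<open>
  The sphere of dimension \<open>d\<close> is \<^term>\<open>sphere (0::real^'n) 1\<close> with \<open>CARD('n) = d + 1\<close>.

  The surface measure is defined by polar coordinates: the area of a Borel set \<open>A\<close> of unit vectors is
  \<open>d + 1\<close> times the Lebesgue measure of the cone of all \<open>r *\<^sub>R a\<close> with \<open>0 < r \<le> 1\<close> and \<open>a \<in> A\<close>,
  which is the preimage of \<open>A\<close> under \<open>sgn x = x /\<^sub>R norm x\<close> in the punctured unit ball.
\<close>

definition surface_measure :: "'a::euclidean_space measure" where
  "surface_measure =
     scale_measure (of_nat DIM('a))
       (distr (restrict_space lborel (cball 0 1 - {0})) (restrict_space borel (sphere 0 1)) sgn)"

definition sphere_measure :: "'a::euclidean_space measure" where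
  "sphere_measure =
     scale_measure (1 / emeasure (surface_measure :: 'a measure) (sphere 0 1)) surface_measure"

definition sphere_inner :: "('a::euclidean_space \<Rightarrow> real) \<Rightarrow> ('a \<Rightarrow> real) \<Rightarrow> real" where
  "sphere_inner f g = (LINT x|sphere_measure. f x * g x)"

definition polynomial_degree_le :: "nat \<Rightarrow> (real^'n \<Rightarrow> real) \<Rightarrow> bool" where
  "polynomial_degree_le \<nu> q \<longleftrightarrow>
     (\<exists>c :: ('n \<Rightarrow> nat) \<Rightarrow> real. \<forall>x. q x =
        (\<Sum>\<alpha> | (\<Sum>i\<in>UNIV. \<alpha> i) \<le> \<nu>. c \<alpha> * (\<Prod>i\<in>UNIV. (x $ i) ^ \<alpha> i)))"

lemma finite_multi_indices: "finite {\<alpha> :: 'n::finite \<Rightarrow> nat. (\<Sum>i\<in>UNIV. \<alpha> i) \<le> \<nu>}"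
proof (rule finite_subset)
  have "\<alpha> i \<le> \<nu>" if "(\<Sum>i\<in>UNIV. \<alpha> i) \<le> \<nu>" for \<alpha> :: "'n \<Rightarrow> nat" and i
    using member_le_sum[of i UNIV \<alpha>] that by simp
  then show "{\<alpha> :: 'n \<Rightarrow> nat. (\<Sum>i\<in>UNIV. \<alpha> i) \<le> \<nu>} \<subseteq> (UNIV :: 'n set) \<rightarrow>\<^sub>E {..\<nu>}"
    by auto
  show "finite ((UNIV :: 'n set) \<rightarrow>\<^sub>E {..\<nu>})"
    by (intro finite_PiE) auto
qed

text \<open>The classical explicit formula (DLMF 18.5.8); its value at 1 is the generalised binomial
  coefficient \<open>(n + \<alpha>) gchoose n\<close>.\<close>

definition jacobi_poly :: "real \<Rightarrow> real \<Rightarrow> nat \<Rightarrow> real \<Rightarrow> real" where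
  "jacobi_poly \<alpha> \<beta> n t =
     (\<Sum>s\<le>n. ((real n + \<alpha>) gchoose (n - s)) * ((real n + \<beta>) gchoose s)
        * ((t - 1) / 2) ^ s * ((t + 1) / 2) ^ (n - s))"

lemma jacobi_poly_at_1: "jacobi_poly \<alpha> \<beta> n 1 = (real n + \<alpha>) gchoose n"
proof -
  have "jacobi_poly \<alpha> \<beta> n 1 =
      (\<Sum>s\<le>n. if s = 0 then (real n + \<alpha>) gchoose n else 0)"
    unfolding jacobi_poly_def by (intro sum.cong) (auto simp: power_0_left)
  then show ?thesis by simp
qed

definition gegenbauer_normalized :: "nat \<Rightarrow> nat \<Rightarrow> real \<Rightarrow> real" where
  "gegenbauer_normalized d l t =
     jacobi_poly ((real d - 2) / 2) ((real d - 2) / 2) l t /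
     jacobi_poly ((real d - 2) / 2) ((real d - 2) / 2) l 1"

definition harmonic_dim :: "nat \<Rightarrow> nat \<Rightarrow> real" where
  "harmonic_dim d l =
     (2 * real l + real d - 1) * (Gamma (real l + real d - 1) / (Gamma (real d) * Gamma (real l + 1)))"

definition C_k_on :: "nat \<Rightarrow> real set \<Rightarrow> (real \<Rightarrow> real) \<Rightarrow> bool" where
  "C_k_on k S f \<longleftrightarrow>
     (\<exists>D :: nat \<Rightarrow> real \<Rightarrow> real. (\<forall>t\<in>S. D 0 t = f t) \<and>
        (\<forall>i<k. \<forall>t\<in>S. (D i has_real_derivative D (Suc i) t) (at t within S)) \<and>
        continuous_on S (D k))"

text \<open>Filters are functions on \<open>{0..}\<close>; their values at negative arguments are irrelevant.\<close>

definition needlet_filter :: "(real \<Rightarrow> real) \<Rightarrow> bool" where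
  "needlet_filter h \<longleftrightarrow>
     (\<forall>t\<ge>0. h t \<ge> 0) \<and>
     (\<exists>\<kappa>\<ge>1. C_k_on \<kappa> {0..} h) \<and>
     closure {t. t \<ge> 0 \<and> h t \<noteq> 0} = {1/2..2} \<and>
     (\<forall>t\<in>{1/2..1}. (h t)\<^sup>2 + (h (2 * t))\<^sup>2 = 1)"

definition filter_H :: "(real \<Rightarrow> real) \<Rightarrow> real \<Rightarrow> real" where
  "filter_H h t = (if t < 1 then 1 else (h t)\<^sup>2)"

text \<open>For filters supported in \<open>[0,2]\<close> and \<open>T \<ge> 1\<close> only the terms with \<open>l \<le> 2 * T\<close> are nonzero.\<close>

definition filtered_kernel :: "nat \<Rightarrow> real \<Rightarrow> (real \<Rightarrow> real) \<Rightarrow> real \<Rightarrow> real" where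
  "filtered_kernel d T g t =
     (if T < 1 then 1
      else (\<Sum>l. g (real l / T) * harmonic_dim d l * gegenbauer_normalized d l t))"

definition filtered_approx ::
  "nat \<Rightarrow> real \<Rightarrow> (real \<Rightarrow> real) \<Rightarrow> (real^'n \<Rightarrow> real) \<Rightarrow> real^'n \<Rightarrow> real" where
  "filtered_approx d T g f x = (LINT y|sphere_measure. f y * filtered_kernel d T g (x \<bullet> y))"

definition needlet_quadrature ::
  "(nat \<Rightarrow> nat) \<Rightarrow> (nat \<Rightarrow> nat \<Rightarrow> real) \<Rightarrow> (nat \<Rightarrow> nat \<Rightarrow> real^'n) \<Rightarrow> bool" where
  "needlet_quadrature N w p \<longleftrightarrow>
     (\<forall>j. (\<forall>k\<in>{1..N j}. w j k > 0 \<and> p j k \<in> sphere 0 1) \<and>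
          (\<forall>q. polynomial_degree_le (2 ^ (j + 1) - 1) q \<longrightarrow>
             (LINT x|sphere_measure. q x) = (\<Sum>k=1..N j. w j k * q (p j k))))"

definition needlet ::
  "nat \<Rightarrow> (real \<Rightarrow> real) \<Rightarrow> (nat \<Rightarrow> nat \<Rightarrow> real) \<Rightarrow> (nat \<Rightarrow> nat \<Rightarrow> real^'n) \<Rightarrow>
   nat \<Rightarrow> nat \<Rightarrow> real^'n \<Rightarrow> real" where
  "needlet d h w p j k x =
     sqrt (w j k) * filtered_kernel d (2 powi (int j - 1)) h (x \<bullet> p j k)"

definition semidiscrete_needlet_approx ::
  "nat \<Rightarrow> (real \<Rightarrow> real) \<Rightarrow> (nat \<Rightarrow> nat) \<Rightarrow> (nat \<Rightarrow> nat \<Rightarrow> real) \<Rightarrow> (nat \<Rightarrow> nat \<Rightarrow> real^'n) \<Rightarrow>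
   nat \<Rightarrow> (real^'n \<Rightarrow> real) \<Rightarrow> real^'n \<Rightarrow> real" where
  "semidiscrete_needlet_approx d h N w p J f x =
     (\<Sum>j=0..J. \<Sum>k=1..N j.
        sphere_inner f (needlet d h w p j k) * needlet d h w p j k x)"

subsection \<open>The normalised measure is a probability measure\<close>

lemma space_surface_measure: "space (surface_measure :: 'a::euclidean_space measure) = sphere 0 1"
  by (simp add: surface_measure_def space_restrict_space space_scale_measure)

lemma space_sphere_measure: "space (sphere_measure :: 'a::euclidean_space measure) = sphere 0 1"
  by (simp add: sphere_measure_def space_surface_measure space_scale_measure)

lemma sets_sphere_measure:
  "sets (sphere_measure :: 'a::euclidean_space measure) = sets (restrict_space borel (sphere 0 1))"
  by (simp add: sphere_measure_def surface_measure_def)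

lemma emeasure_surface_measure:
  fixes A :: "'a::euclidean_space set"
  assumes "A \<in> sets borel" "A \<subseteq> sphere 0 1"
  shows "emeasure surface_measure A =
    of_nat DIM('a) * emeasure lborel {x \<in> cball 0 1 - {0}. sgn x \<in> A}"
proof -
  let ?B = "cball 0 1 - {0} :: 'a set"
  have m: "sgn \<in> restrict_space lborel ?B \<rightarrow>\<^sub>M restrict_space borel (sphere 0 1)"
  proof (rule measurable_restrict_space2)
    show "sgn \<in> space (restrict_space lborel ?B) \<rightarrow> sphere (0::'a) 1"
      by (auto simp: space_restrict_space norm_sgn)
    have "sgn \<in> borel_measurable (borel :: 'a measure)"
      unfolding sgn_div_norm[abs_def] by measurable
    then show "sgn \<in> restrict_space lborel ?B \<rightarrow>\<^sub>M borel"
      by (intro measurable_restrict_space1) simp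
  qed
  have A: "A \<in> sets (restrict_space borel (sphere 0 1))"
    using assms by (auto simp: sets_restrict_space)
  have "sgn -` A \<inter> space (restrict_space lborel ?B) = {x \<in> ?B. sgn x \<in> A}"
    by (auto simp: space_restrict_space)
  moreover have "emeasure (restrict_space lborel ?B) {x \<in> ?B. sgn x \<in> A} =
      emeasure lborel {x \<in> ?B. sgn x \<in> A}"
    by (rule emeasure_restrict_space) auto
  ultimately show ?thesis
    unfolding surface_measure_def emeasure_scale_measure emeasure_distr[OF m A] by simp
qed

lemma emeasure_surface_measure_sphere:
  "emeasure (surface_measure :: 'a::euclidean_space measure) (sphere 0 1) =
     ennreal (DIM('a) * unit_ball_vol DIM('a))"
proof -
  have "{x \<in> cball 0 1 - {0}. sgn x \<in> sphere 0 1} = cball (0::'a) 1 - {0}"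
    by (auto simp: norm_sgn)
  moreover have "emeasure lborel (cball (0::'a) 1 - {0}) = unit_ball_vol DIM('a)"
    by (subst emeasure_Diff) (auto simp: emeasure_cball)
  ultimately show ?thesis
    by (subst emeasure_surface_measure)
       (auto simp: ennreal_mult ennreal_of_nat_eq_real_of_nat)
qed

lemma emeasure_sphere_measure_sphere:
  "emeasure (sphere_measure :: 'a::euclidean_space measure) (sphere 0 1) = 1"
proof -
  have "real DIM('a) * unit_ball_vol (real DIM('a)) > 0"
    by (intro mult_pos_pos) auto
  then show ?thesis
    unfolding sphere_measure_def emeasure_scale_measure emeasure_surface_measure_sphere
    by (metis divide_ennreal ennreal_1 ennreal_mult'' less_imp_le nonzero_eq_divide_eq
        less_irrefl zero_less_one)
qed

end

theory Submission
  imports Defs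
begin

text \<open>
  Since \<open>h t = 0\<close> for \<open>t \<ge> 2\<close>, the product of two level-\<open>j\<close> kernels is a polynomial of degree below
  \<open>2 ^ (j + 1)\<close>, so the quadrature turns the sum over \<open>k\<close> into the convolution of the kernel with itself,
  which replaces \<open>h\<close> by \<open>h\<^sup>2\<close>. The levels then add up because \<open>H t = H (2 * t) + (h t)\<^sup>2\<close>.

  The convolution needs the reproducing property of \<open>Z(d,l) P_l\<close>. It is obtained without spherical
  harmonics: rotation invariance of the measure gives an integration by parts formula for the integrals
  of \<open>P (x \<bullet> y) * R (z \<bullet> y)\<close> over \<open>y\<close>. With the ladder relations of the Gegenbauer polynomials, it shows
  by induction on \<open>l\<close> (Funk-Hecke) that integrating \<open>P_l (x \<bullet> y) * R (z \<bullet> y)\<close> gives \<open>P_l (x \<bullet> z)\<close>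
  times the moment of \<open>P_l * R\<close>.
\<close>

subsection \<open>Gegenbauer polynomials\<close>

text \<open>For \<open>c = d\<close> this is the Laplace-Beltrami operator of the
  \<open>d\<close>-sphere, acting on functions of the inner product with a fixed pole.\<close>

definition gegenbauer_operator :: "real \<Rightarrow> real poly \<Rightarrow> real poly" where
  "gegenbauer_operator c p = [:1, 0, -1:] * pderiv (pderiv p) - smult c ([:0, 1:] * pderiv p)"

section \<open>Uniqueness of eigenpolynomials and the ladder operators\<close>

lemma poly_eq_by_eval: "(\<And>t. poly p t = poly q t) \<Longrightarrow> p = (q :: real poly)"
  by (simp add: poly_eq_poly_eq_iff[symmetric] ext)

text \<open>Differentiating the equation \<open>k\<close> times and setting \<open>t = 1\<close>
  removes the term with \<open>1 - t^2\<close> and leaves \<open>2 k + c > 0\<close> times the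
  derivative of order \<open>k + 1\<close> as a multiple of the one of order \<open>k\<close>. So
  every derivative vanishes at 1, while the one of order \<open>degree p\<close> is a nonzero
  constant unless \<open>p = 0\<close>.\<close>

lemma gegenbauer_eigen_unique_0:
  assumes c: "c > 0" and eig: "gegenbauer_operator c p = smult (-\<mu>) p" and p1: "poly p 1 = 0"
  shows "p = 0"
proof -
  let ?D = "\<lambda>k. (pderiv ^^ k) p"
  have ode: "[:1, 0, -1:] * ?D (k + 2) - smult (2 * real k + c) ([:0, 1:] * ?D (k + 1))
      + smult (\<mu> - real k * (real k - 1) - c * real k) (?D k) = 0" for k
  proof (induction k)
    case 0
    show ?case
      using eig by (simp add: gegenbauer_operator_def numeral_2_eq_2)
  next
    case (Suc k)
    then have "pderiv ([:1, 0, -1:] * ?D (k + 2) - smult (2 * real k + c) ([:0, 1:] * ?D (k + 1))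
      + smult (\<mu> - real k * (real k - 1) - c * real k) (?D k)) = 0" by simp
    then have "\<forall>t. poly (pderiv ([:1, 0, -1:] * ?D (k + 2) - smult (2 * real k + c) ([:0, 1:] * ?D (k + 1))
      + smult (\<mu> - real k * (real k - 1) - c * real k) (?D k))) t = 0" by simp
    then show ?case
      by (intro poly_eq_by_eval)
         (simp add: pderiv_mult pderiv_diff pderiv_add pderiv_smult pderiv_pCons
           algebra_simps del: mult_pCons_left mult_pCons_right)
  qed
  have D1: "poly (?D k) 1 = 0" for k
  proof (induction k)
    case 0
    show ?case using p1 by simp
  next
    case (Suc k)
    from arg_cong[OF ode[of k], of "\<lambda>q. poly q 1"] Suc
    have "(2 * real k + c) * poly (?D (Suc k)) 1 = 0" by simp
    with c show ?case by (simp add: add_nonneg_eq_0_iff)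
  qed
  show ?thesis
  proof (rule ccontr)
    assume "p \<noteq> 0"
    define n where "n = degree p"
    have "degree (?D n) = 0"
      by (simp add: degree_higher_pderiv n_def)
    then have "poly (?D n) 1 = coeff (?D n) 0"
      by (elim degree_eq_zeroE) simp
    moreover have "coeff (?D n) 0 = pochhammer 1 n * lead_coeff p"
      by (simp add: coeff_higher_pderiv n_def)
    ultimately show False
      using D1[of n] \<open>p \<noteq> 0\<close> by (simp add: pochhammer_fact[symmetric])
  qed
qed

lemma gegenbauer_operator_diff:
  "gegenbauer_operator c (p - q) = gegenbauer_operator c p - gegenbauer_operator c q"
  by (simp add: gegenbauer_operator_def pderiv_diff algebra_simps smult_diff_right)

lemma gegenbauer_operator_smult:
  "gegenbauer_operator c (smult a p) = smult a (gegenbauer_operator c p)"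
  by (rule poly_eq_by_eval) (simp add: gegenbauer_operator_def pderiv_smult algebra_simps)

lemma gegenbauer_operator_minus: "gegenbauer_operator c (- p) = - gegenbauer_operator c p"
  using gegenbauer_operator_smult[of c "-1" p] by simp

lemma gegenbauer_operator_0 [simp]: "gegenbauer_operator c 0 = 0"
  by (simp add: gegenbauer_operator_def)

lemma gegenbauer_operator_add:
  "gegenbauer_operator c (p + q) = gegenbauer_operator c p + gegenbauer_operator c q"
  by (simp add: gegenbauer_operator_def pderiv_add algebra_simps smult_add_right)

lemma gegenbauer_operator_sum:
  "gegenbauer_operator c (\<Sum>i\<in>A. f i) = (\<Sum>i\<in>A. gegenbauer_operator c (f i))"
  by (induction A rule: infinite_finite_induct) (simp_all add: gegenbauer_operator_add)

lemma gegenbauer_eigen_unique: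
  assumes "c > 0" "gegenbauer_operator c p = smult (-\<mu>) p" "gegenbauer_operator c q = smult (-\<mu>) q"
    and "poly p 1 = poly q 1"
  shows "p = q"
  using gegenbauer_eigen_unique_0[of c "p - q" \<mu>] assms
  by (simp add: gegenbauer_operator_diff smult_diff_right)

text \<open>The operator \<open>k t + (1 - t^2) d/dt\<close> lowers the degree parameter
  \<open>k\<close> by one. Since \<open>k (k + c - 1)\<close> is unchanged when \<open>k\<close>
  becomes \<open>1 - c - k\<close>, a negative \<open>k\<close> turns the same statement into the
  raising relation. The claim is an algebraic consequence of the eigenvalue equation
  \<open>e1\<close> and its derivative \<open>e2\<close>.\<close>

lemma gegenbauer_ladder:
  assumes eig: "gegenbauer_operator c p = smult (-\<mu>) p"
    and \<mu>: "\<mu> = k * (k + c - 1)" and \<nu>: "\<nu> = (k - 1) * (k + c - 2)"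
  shows "gegenbauer_operator c (smult k ([:0, 1:] * p) + [:1, 0, -1:] * pderiv p) =
    smult (-\<nu>) (smult k ([:0, 1:] * p) + [:1, 0, -1:] * pderiv p)" (is "_ = smult _ ?q")
proof (rule poly_eq_by_eval)
  fix t :: real
  let ?p1 = "poly (pderiv p) t" and ?p2 = "poly (pderiv (pderiv p)) t"
    and ?p3 = "poly (pderiv (pderiv (pderiv p))) t"
  have e1: "(1 - t\<^sup>2) * ?p2 - c * t * ?p1 = - (k * (k + c - 1)) * poly p t"
    using arg_cong[OF eig[unfolded \<mu>], of "\<lambda>q. poly q t"]
    by (simp add: gegenbauer_operator_def power2_eq_square algebra_simps)
  have e2: "(1 - t\<^sup>2) * ?p3 - (2 + c) * t * ?p2 - c * ?p1 = - (k * (k + c - 1)) * ?p1"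
    using arg_cong[OF eig[unfolded \<mu>], of "\<lambda>q. poly (pderiv q) t"]
    by (simp add: gegenbauer_operator_def power2_eq_square pderiv_mult pderiv_diff pderiv_smult
        pderiv_pCons pderiv_minus algebra_simps del: mult_pCons_left mult_pCons_right)
  show "poly (gegenbauer_operator c ?q) t = poly (smult (-\<nu>) ?q) t"
    using e1 e2
    by (simp add: gegenbauer_operator_def power2_eq_square pderiv_mult pderiv_diff pderiv_add pderiv_smult
        pderiv_pCons pderiv_minus \<nu> del: mult_pCons_left mult_pCons_right)
      algebra
qed

text \<open>With \<open>A = (t - 1) / 2\<close> and \<open>B = (t + 1) / 2\<close> one has
  \<open>1 - t^2 = - 4 A B\<close> and \<open>t = A + B\<close>, so the operator preserves the total
  exponent \<open>s + r\<close> and only couples neighbouring products. Where \<open>s - 1\<close>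
  or \<open>r - 1\<close> is truncated at 0, its coefficient vanishes.\<close>

lemma gegenbauer_operator_basis:
  fixes a :: real
  defines "u \<equiv> \<lambda>s r. [:-1/2, 1/2:] ^ s * [:1/2, 1/2:] ^ r :: real poly"
  shows "gegenbauer_operator (2 * a + 2) (u s r) =
     - smult (real s * (real s + a)) (u (s - 1) (r + 1))
     - smult (real r * (real r + a)) (u (s + 1) (r - 1))
     - smult (2 * real s * real r + (a + 1) * (real s + real r)) (u s r)"
proof (rule poly_eq_by_eval)
  fix t :: real
  have d: "pderiv (u s r) = smult (real s / 2) (u (s - 1) r) + smult (real r / 2) (u s (r - 1))" for s r
    by (rule poly_eq_by_eval)
       (simp add: u_def pderiv_mult pderiv_power pderiv_pCons algebra_simps)
  define A B where "A = (t - 1) / 2" and "B = (t + 1) / 2"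
  have u: "poly (u s r) t = A ^ s * B ^ r" for s r
    by (simp add: u_def A_def B_def field_simps)
  have t: "t = A + B" "A = B - 1"
    by (simp_all add: A_def B_def field_simps)
  show "poly (gegenbauer_operator (2 * a + 2) (u s r)) t =
     poly (- smult (real s * (real s + a)) (u (s - 1) (r + 1))
     - smult (real r * (real r + a)) (u (s + 1) (r - 1))
     - smult (2 * real s * real r + (a + 1) * (real s + real r)) (u s r)) t"
  proof -
    \<comment> \<open>Exponents 0 and 1 are split off because two derivatives subtract up to 2 from
      an exponent and natural subtraction truncates there.\<close>
    have "n = 0 \<or> n = 1 \<or> (\<exists>m. n = Suc (Suc m))" for n :: nat
      by presburger
    from this[of s] this[of r]
    consider "s = 0" "r = 0" | "s = 0" "r = 1" | m where "s = 0" "r = Suc (Suc m)"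
      | "s = 1" "r = 0" | "s = 1" "r = 1" | m where "s = 1" "r = Suc (Suc m)"
      | n where "s = Suc (Suc n)" "r = 0" | n where "s = Suc (Suc n)" "r = 1"
      | n m where "s = Suc (Suc n)" "r = Suc (Suc m)"
      by blast
    then show ?thesis
      apply cases
      apply (simp_all add: gegenbauer_operator_def d u pderiv_add pderiv_smult)
      apply (simp_all add: t)
      apply (simp_all add: field_simps)
      done
  qed
qed

section \<open>The Jacobi sum as an eigenpolynomial, and its recurrences\<close>

text \<open>A copy of \<open>gegenbauer_normalized\<close> of type \<open>real poly\<close>, which
  makes \<open>pderiv\<close> and \<open>degree\<close> available; the two linear factors are
  \<open>(t - 1) / 2\<close> and \<open>(t + 1) / 2\<close>.\<close>

definition gegenbauer_poly :: "nat \<Rightarrow> nat \<Rightarrow> real poly" where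
  "gegenbauer_poly d l =
     (let a = (real d - 2) / 2 in
      smult (1 / jacobi_poly a a l 1)
        (\<Sum>s\<le>l. smult (((real l + a) gchoose (l - s)) * ((real l + a) gchoose s))
           ([:-1/2, 1/2:] ^ s * [:1/2, 1/2:] ^ (l - s))))"

lemma poly_gegenbauer_poly: "poly (gegenbauer_poly d l) t = gegenbauer_normalized d l t"
proof -
  have "poly [:-1/2, 1/2:] t = (t - 1) / 2" "poly [:1/2, 1/2:] t = (t + 1) / 2"
    by (simp_all add: field_simps)
  then show ?thesis
    by (simp only: gegenbauer_poly_def gegenbauer_normalized_def jacobi_poly_def[of _ _ l t] poly_sum
        poly_smult poly_mult poly_power Let_def mult.assoc) simp
qed

lemma gegenbauer_poly_1:
  assumes "d \<ge> 2"
  shows "poly (gegenbauer_poly d l) 1 = 1"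
proof -
  have "(real l + (real d - 2) / 2) gchoose l > 0"
    using assms unfolding gbinomial_prod_rev
    by (intro divide_pos_pos prod_pos) (auto intro: less_le_trans[of _ "real l"])
  then show ?thesis
    by (simp add: poly_gegenbauer_poly gegenbauer_normalized_def jacobi_poly_at_1)
qed

text \<open>The coefficient ratio \<open>rec\<close> makes the two neighbour sums of
  \<open>gegenbauer_operator_basis\<close> diagonal after an index shift. What remains in front of
  \<open>u s (l - s)\<close> is independent of \<open>s\<close>, namely
  \<open>- l (l + 2 a + 1)\<close> with \<open>2 a + 2 = d\<close>.\<close>

lemma gegenbauer_poly_eigen:
  "gegenbauer_operator (real d) (gegenbauer_poly d l) =
     smult (- (real l * (real l + real d - 1))) (gegenbauer_poly d l)"
proof -
  define a where "a = (real d - 2) / 2"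
  define u :: "nat \<Rightarrow> nat \<Rightarrow> real poly" where "u = (\<lambda>s r. [:-1/2, 1/2:] ^ s * [:1/2, 1/2:] ^ r)"
  define c where "c s = ((real l + a) gchoose (l - s)) * ((real l + a) gchoose s)" for s
  have d: "real d = 2 * a + 2"
    by (simp add: a_def field_simps)
  have rec: "c (Suc s) * (real (Suc s) * (real (Suc s) + a)) =
      c s * (real (l - s) * (real (l - s) + a))" if "s < l" for s
  proof -
    have g: "real (Suc k) * ((real l + a) gchoose Suc k) = (real l + a - real k) * ((real l + a) gchoose k)" for k
      using gbinomial_mult_1[of "real l + a" k] by (simp add: algebra_simps)
    define r where "r = l - Suc s"
    have r: "l - s = Suc r" "l - Suc s = r" "real l = real s + real r + 1"
      using that by (auto simp: r_def)
    have "c (Suc s) * (real (Suc s) * (real (Suc s) + a)) =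
        (real (Suc s) * ((real l + a) gchoose Suc s)) * ((real l + a - real r) * ((real l + a) gchoose r))"
      by (simp add: c_def r)
    also have "\<dots> = ((real l + a - real s) * ((real l + a) gchoose s)) * (real (Suc r) * ((real l + a) gchoose Suc r))"
      by (simp only: g)
    also have "\<dots> = c s * (real (l - s) * (real (l - s) + a))"
      by (simp add: c_def r)
    finally show ?thesis .
  qed
  \<comment> \<open>A shift of \<open>s\<close> by one: the term \<open>s = 0\<close> on the left
    and the term \<open>s = l\<close> on the right vanish, so no boundary terms appear. The sum
    \<open>up\<close> is the mirror image.\<close>
  have down: "(\<Sum>s\<le>l. smult (c s * (real s * (real s + a))) (u (s - 1) (l - s + 1))) =
      (\<Sum>s\<le>l. smult (c s * (real (l - s) * (real (l - s) + a))) (u s (l - s)))"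
    by (subst sum.atMost_shift, unfold lessThan_Suc_atMost[symmetric] sum.lessThan_Suc)
       (simp add: rec[simplified] Suc_diff_Suc cong: sum.cong_simp)
  have up: "(\<Sum>s\<le>l. smult (c s * (real (l - s) * (real (l - s) + a))) (u (s + 1) (l - s - 1))) =
      (\<Sum>s\<le>l. smult (c s * (real s * (real s + a))) (u s (l - s)))"
    by (subst (2) sum.atMost_shift, unfold lessThan_Suc_atMost[symmetric] sum.lessThan_Suc)
       (simp add: rec[simplified] cong: sum.cong_simp)
  have basis: "gegenbauer_operator (2 * a + 2) (u s r) =
     - smult (real s * (real s + a)) (u (s - 1) (r + 1))
     - smult (real r * (real r + a)) (u (s + 1) (r - 1))
     - smult (2 * real s * real r + (a + 1) * (real s + real r)) (u s r)" for s r
    unfolding u_def by (rule gegenbauer_operator_basis)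
  define S where "S = (\<Sum>s\<le>l. smult (c s) (u s (l - s)))"
  have "gegenbauer_operator (real d) S =
    - (\<Sum>s\<le>l. smult (c s * (real s * (real s + a))) (u (s - 1) (l - s + 1)))
    - (\<Sum>s\<le>l. smult (c s * (real (l - s) * (real (l - s) + a))) (u (s + 1) (l - s - 1)))
    - (\<Sum>s\<le>l. smult (c s * (2 * real s * real (l - s) + (a + 1) * (real s + real (l - s)))) (u s (l - s)))"
    unfolding S_def gegenbauer_operator_sum gegenbauer_operator_smult d basis
    by (simp add: smult_diff_right sum_subtractf sum_negf)
  also have "\<dots> = (\<Sum>s\<le>l. smult (- (real l * (real l + real d - 1)) * c s) (u s (l - s)))"
    unfolding down up
    by (simp add: sum_subtractf[symmetric] sum_negf[symmetric] smult_add_left[symmetric]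
        smult_diff_left[symmetric] smult_minus_left[symmetric] d of_nat_diff algebra_simps
        del: smult_minus_left cong: sum.cong_simp)
  also have "\<dots> = smult (- (real l * (real l + real d - 1))) S"
    unfolding S_def
    by (rule poly_eq_by_eval) (simp add: poly_sum sum_distrib_left mult.assoc sum_negf)
  finally show ?thesis
    by (simp add: gegenbauer_poly_def Let_def S_def c_def u_def a_def gegenbauer_operator_smult mult.commute)
qed

lemma degree_gegenbauer_poly: "degree (gegenbauer_poly d l) \<le> l"
  unfolding gegenbauer_poly_def Let_def
  by (intro degree_smult_le[THEN order_trans] degree_sum_le degree_mult_le[THEN order_trans])
     (auto simp: degree_power_eq)

text \<open>By the ladder both sides are eigenpolynomials for the same eigenvalue, and both equal
  \<open>l + 1\<close> at 1, where the derivative term drops out.\<close>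

lemma gegenbauer_poly_down:
  assumes "d \<ge> 2"
  shows "smult (real l + 1) (gegenbauer_poly d l) =
    smult (real l + 1) ([:0, 1:] * gegenbauer_poly d (Suc l)) + [:1, 0, -1:] * pderiv (gegenbauer_poly d (Suc l))"
    (is "_ = ?q")
proof (rule gegenbauer_eigen_unique)
  show "gegenbauer_operator (real d) ?q = smult (- (real l * (real l + real d - 1))) ?q"
    by (rule gegenbauer_ladder[OF gegenbauer_poly_eigen]) (simp_all add: algebra_simps)
qed (use assms in \<open>simp_all add: gegenbauer_operator_smult gegenbauer_poly_eigen gegenbauer_poly_1 mult.commute\<close>)

lemma gegenbauer_poly_up:
  assumes "d \<ge> 2"
  shows "smult (real l + real d - 1) (gegenbauer_poly d (Suc l)) =
    smult (real l + real d - 1) ([:0, 1:] * gegenbauer_poly d l) - [:1, 0, -1:] * pderiv (gegenbauer_poly d l)"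
    (is "_ = ?q")
proof (rule gegenbauer_eigen_unique)
  let ?p = "gegenbauer_poly d l"
  \<comment> \<open>The ladder with \<open>k = - (l + d - 1)\<close>, which has the eigenvalue of
    degree \<open>l\<close> and leads to that of degree \<open>l + 1\<close>.\<close>
  have "gegenbauer_operator (real d) (smult (- (real l + real d - 1)) ([:0, 1:] * ?p) + [:1, 0, -1:] * pderiv ?p) =
      smult (- (real (Suc l) * (real (Suc l) + real d - 1)))
        (smult (- (real l + real d - 1)) ([:0, 1:] * ?p) + [:1, 0, -1:] * pderiv ?p)"
    by (rule gegenbauer_ladder[OF gegenbauer_poly_eigen]) (simp_all add: algebra_simps)
  also have "smult (- (real l + real d - 1)) ([:0, 1:] * ?p) + [:1, 0, -1:] * pderiv ?p = - ?q"
    by (simp only: smult_minus_left)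
  finally show "gegenbauer_operator (real d) ?q = smult (- (real (Suc l) * (real (Suc l) + real d - 1))) ?q"
    by (simp only: gegenbauer_operator_minus smult_minus_right neg_equal_iff_equal)
qed (use assms in \<open>simp_all add: gegenbauer_operator_smult gegenbauer_poly_eigen gegenbauer_poly_1 mult.commute\<close>)

lemma gegenbauer_poly_0:
  assumes "d \<ge> 2"
  shows "gegenbauer_poly d 0 = 1"
proof -
  obtain a where a: "gegenbauer_poly d 0 = [:a:]"
    using degree_gegenbauer_poly[of d 0] by (auto elim: degree_eq_zeroE)
  then show ?thesis
    using gegenbauer_poly_1[OF assms, of 0] by (simp add: one_pCons)
qed

text \<open>Adding the lowering relation of degree \<open>l - 1\<close> and the raising relation of
  degree \<open>l\<close> cancels the derivative. For \<open>l = 0\<close> the truncated index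
  \<open>l - 1\<close> comes with coefficient 0.\<close>

lemma gegenbauer_poly_recurrence:
  assumes "d \<ge> 2"
  shows "smult (2 * real l + real d - 1) ([:0, 1:] * gegenbauer_poly d l) =
    smult (real l) (gegenbauer_poly d (l - 1)) + smult (real l + real d - 1) (gegenbauer_poly d (Suc l))"
proof (cases l)
  case 0
  then show ?thesis
    using gegenbauer_poly_up[OF assms, of 0] by (simp add: gegenbauer_poly_0[OF assms])
next
  case (Suc k)
  have "smult (real l) (gegenbauer_poly d (l - 1)) =
      smult (real l) ([:0, 1:] * gegenbauer_poly d l) + [:1, 0, -1:] * pderiv (gegenbauer_poly d l)"
    using gegenbauer_poly_down[OF assms, of k]
    by (simp add: Suc add.commute[of 1] del: mult_pCons_left)
  then show ?thesis
    by (simp add: gegenbauer_poly_up[OF assms] smult_add_left[symmetric] add_diff_eq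
        del: mult_pCons_left)
qed

section \<open>Dimensions of the spaces of spherical harmonics\<close>

lemma harmonic_dim_0:
  assumes "d \<ge> 2"
  shows "harmonic_dim d 0 = 1"
proof -
  have "Gamma (real d) = (real d - 1) * Gamma (real d - 1)"
    using Gamma_plus1[of "real d - 1"] assms by (auto simp: nonpos_Ints_def)
  moreover have "Gamma (real d - 1) \<noteq> 0"
    using Gamma_real_pos[of "real d - 1"] assms by linarith
  moreover have "(real d - 1) * (\<gamma> / ((real d - 1) * \<gamma>)) = 1" if "\<gamma> \<noteq> 0" for \<gamma> :: real
    using assms that by simp
  ultimately show ?thesis
    by (simp add: harmonic_dim_def)
qed

lemma harmonic_dim_pos:
  assumes "d \<ge> 2"
  shows "harmonic_dim d l > 0"
  unfolding harmonic_dim_def using assms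
  by (intro mult_pos_pos divide_pos_pos Gamma_real_pos) auto

text \<open>The functional equation of \<open>Gamma\<close>, multiplied out into the form in which
  the ratio of consecutive squared norms appears in \<open>gegenbauer_norm\<close>.\<close>

lemma harmonic_dim_Suc:
  assumes "d \<ge> 2"
  shows "(2 * real l + real d - 1) * (real l + 1) * harmonic_dim d (Suc l) =
    (2 * real l + real d + 1) * (real l + real d - 1) * harmonic_dim d l"
proof -
  have 1: "Gamma (real l + real d) = (real l + real d - 1) * Gamma (real l + real d - 1)"
    using Gamma_plus1[of "real l + real d - 1"] assms by (auto simp: nonpos_Ints_def)
  have 2: "Gamma (real (Suc l) + 1) = (real l + 1) * Gamma (real l + 1)"
    using Gamma_plus1[of "real l + 1"] by (auto simp: nonpos_Ints_def add_ac)
  have 3: "real (Suc l) + real d - 1 = real l + real d" "2 * real (Suc l) + real d - 1 = 2 * real l + real d + 1"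
    by simp_all
  show ?thesis
    unfolding harmonic_dim_def 2 3 1 by simp
qed

subsection \<open>Rotation invariance of the sphere measure\<close>

lemma nn_integral_lborel_translate:
  fixes g :: "'a::euclidean_space \<Rightarrow> ennreal"
  assumes "g \<in> borel_measurable borel"
  shows "(\<integral>\<^sup>+x. g (c + x) \<partial>lborel) = (\<integral>\<^sup>+x. g x \<partial>lborel)"
proof -
  have "(\<integral>\<^sup>+x. g x \<partial>lborel) = (\<integral>\<^sup>+x. g x \<partial>distr lborel borel ((+) c))"
    by (simp add: lborel_distr_plus)
  also have "\<dots> = (\<integral>\<^sup>+x. g (c + x) \<partial>lborel)"
    using assms by (subst nn_integral_distr) auto
  finally show ?thesis ..
qed

text \<open>Uniqueness of Haar measure, specialised to the image of Lebesgue measure: convolving with the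
  indicator of the unit ball, which \<open>T\<close> preserves, determines the normalising constant.\<close>

lemma emeasure_lborel_vimage_orthogonal:
  fixes T :: "'a::euclidean_space \<Rightarrow> 'a"
  assumes T: "orthogonal_transformation T" and A[measurable]: "A \<in> sets borel"
  shows "emeasure lborel (T -` A) = emeasure lborel A"
proof -
  define B where "B = ball (0::'a) 1"
  have [measurable]: "B \<in> sets borel"
    by (simp add: B_def)
  have lin: "linear T" and norm_T: "norm (T x) = norm x" for x
    using T by (auto simp: orthogonal_transformation)
  have [measurable]: "T \<in> borel_measurable borel"
    using lin by (intro borel_measurable_continuous_onI linear_continuous_on) (simp add: linear_linear)
  from measurable_sets_borel[OF this A] have [measurable]: "T -` A \<in> sets borel" by simp
  have surj: "T (inv T y) = y" for y
    using T by (simp add: orthogonal_transformation_surj surj_f_inv_f)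
  have "linear (inv T)"
    using T by (intro orthogonal_transformation_linear orthogonal_transformation_inv)
  then have [measurable]: "inv T \<in> borel_measurable borel"
    by (intro borel_measurable_continuous_onI linear_continuous_on) (simp add: linear_linear)
  \<comment> \<open>An isometry pulls a unit ball back to a unit ball, so this inner integral is the
    same constant for every \<open>y\<close>.\<close>
  have slice: "(\<integral>\<^sup>+x. indicator B (y - T x) \<partial>lborel) = emeasure lborel B" for y
  proof -
    have "y - T x \<in> B \<longleftrightarrow> x \<in> ball (inv T y) 1" for x
      using norm_T[of "inv T y - x"] by (simp add: B_def dist_norm linear_diff[OF lin] surj norm_minus_commute)
    then have "(\<integral>\<^sup>+x. indicator B (y - T x) \<partial>lborel) =
        (\<integral>\<^sup>+x. indicator (ball (inv T y) 1) x \<partial>lborel)"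
      by (intro nn_integral_cong) (simp add: indicator_def)
    then show ?thesis
      by (simp add: B_def emeasure_ball)
  qed
  have "emeasure lborel (T -` A) * emeasure lborel B =
      (\<integral>\<^sup>+y. (\<integral>\<^sup>+x. indicator A (T x) * indicator B y \<partial>lborel) \<partial>lborel)"
  proof -
    have "(\<integral>\<^sup>+x. indicator A (T x) * indicator B y \<partial>lborel) =
        emeasure lborel (T -` A) * indicator B y" for y
      by (subst nn_integral_multc) (simp_all flip: indicator_vimage)
    then show ?thesis by (simp add: nn_integral_cmult)
  qed
  \<comment> \<open>Translating \<open>x\<close> by \<open>inv T y\<close> inserts \<open>y\<close>
    next to \<open>T x\<close>. After exchanging the integrals, translating \<open>y\<close> by
    \<open>T x\<close> leaves \<open>A\<close> free of \<open>x\<close>.\<close>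
  also have "\<dots> = (\<integral>\<^sup>+y. (\<integral>\<^sup>+x. indicator A (T x + y) * indicator B y \<partial>lborel) \<partial>lborel)"
  proof (rule nn_integral_cong)
    fix y
    show "(\<integral>\<^sup>+x. indicator A (T x) * indicator B y \<partial>lborel) =
        (\<integral>\<^sup>+x. indicator A (T x + y) * indicator B y \<partial>lborel)"
      using nn_integral_lborel_translate[of "\<lambda>x. indicator A (T x) * indicator B y" "inv T y"]
      by (simp add: linear_add[OF lin] surj add.commute)
  qed
  also have "\<dots> = (\<integral>\<^sup>+x. (\<integral>\<^sup>+y. indicator A (T x + y) * indicator B y \<partial>lborel) \<partial>lborel)"
    by (rule lborel_pair.Fubini') measurable
  also have "\<dots> = (\<integral>\<^sup>+x. (\<integral>\<^sup>+y. indicator A y * indicator B (y - T x) \<partial>lborel) \<partial>lborel)"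
  proof (rule nn_integral_cong)
    fix x
    show "(\<integral>\<^sup>+y. indicator A (T x + y) * indicator B y \<partial>lborel) =
        (\<integral>\<^sup>+y. indicator A y * indicator B (y - T x) \<partial>lborel)"
      using nn_integral_lborel_translate[of "\<lambda>y. indicator A y * indicator B (y - T x)" "T x"]
      by simp
  qed
  also have "\<dots> = (\<integral>\<^sup>+y. (\<integral>\<^sup>+x. indicator A y * indicator B (y - T x) \<partial>lborel) \<partial>lborel)"
    by (rule lborel_pair.Fubini') measurable
  also have "\<dots> = (\<integral>\<^sup>+y. indicator A y * emeasure lborel B \<partial>lborel)"
    by (subst nn_integral_cmult) (simp_all add: slice)
  also have "\<dots> = emeasure lborel A * emeasure lborel B"
    by (simp add: nn_integral_multc)
  \<comment> \<open>The unit ball has positive finite volume, so its factor cancels.\<close>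
  finally show ?thesis
    using less_imp_neq[OF unit_ball_vol_pos[of "real DIM('a)"]]
    by (auto simp: B_def emeasure_ball mult.commute[of _ "ennreal _"] ennreal_mult_cancel_left)
qed

section \<open>Integration over the sphere\<close>

lemma finite_measure_sphere_measure: "finite_measure (sphere_measure :: 'a::euclidean_space measure)"
  by (rule finite_measureI) (simp add: space_sphere_measure emeasure_sphere_measure_sphere)

lemma measure_space_sphere_measure [simp]:
  "measure (sphere_measure :: 'a::euclidean_space measure) (space sphere_measure) = 1"
  by (simp add: measure_def space_sphere_measure emeasure_sphere_measure_sphere)

lemma measurable_sphere_measure:
  fixes g :: "'a::euclidean_space \<Rightarrow> 'b::topological_space"
  assumes "continuous_on (sphere 0 1) g"
  shows "g \<in> borel_measurable sphere_measure"
  using borel_measurable_continuous_on_restrict[OF assms]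
  by (simp cong: measurable_cong_sets add: sets_sphere_measure)

lemma bounded_on_sphere:
  fixes g :: "'a::euclidean_space \<Rightarrow> 'b::real_normed_vector"
  assumes "continuous_on (sphere 0 1) g"
  obtains C where "\<And>y. y \<in> sphere 0 1 \<Longrightarrow> norm (g y) \<le> C" "C \<ge> 0"
proof -
  have "bounded (g ` sphere 0 1)"
    using assms by (intro compact_imp_bounded compact_continuous_image) auto
  then obtain C where "\<And>y. y \<in> sphere 0 1 \<Longrightarrow> norm (g y) \<le> C"
    unfolding bounded_iff by blast
  then show ?thesis
    by (intro that[of "max C 0"]) (auto simp: le_max_iff_disj)
qed

lemma integrable_sphere_measure:
  fixes g :: "'a::euclidean_space \<Rightarrow> 'b::{second_countable_topology,banach}"
  assumes "continuous_on (sphere 0 1) g"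
  shows "integrable sphere_measure g"
proof -
  interpret finite_measure "sphere_measure :: 'a measure"
    by (rule finite_measure_sphere_measure)
  obtain C where C: "\<And>y. y \<in> sphere 0 1 \<Longrightarrow> norm (g y) \<le> C"
    using bounded_on_sphere[OF assms] by blast
  show ?thesis
    by (rule integrable_const_bound[of _ C])
       (use C in \<open>auto simp: space_sphere_measure measurable_sphere_measure[OF assms]\<close>)
qed

text \<open>Continuous functions are bounded on the compact sphere. This gives meaning to the
  pairing of a merely integrable \<open>f\<close> with polynomial kernels.\<close>

lemma integrable_sphere_measure_mult:
  fixes f g :: "'a::euclidean_space \<Rightarrow> real"
  assumes f: "integrable sphere_measure f" and g: "continuous_on (sphere 0 1) g"
  shows "integrable sphere_measure (\<lambda>y. f y * g y)"
proof -
  obtain C where C: "\<And>y. y \<in> sphere 0 1 \<Longrightarrow> norm (g y) \<le> C" "C \<ge> 0"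
    using bounded_on_sphere[OF g] by blast
  have [measurable]: "f \<in> borel_measurable sphere_measure" "g \<in> borel_measurable sphere_measure"
    using f measurable_sphere_measure[OF g] by auto
  show ?thesis
  proof (rule Bochner_Integration.integrable_bound)
    show "integrable sphere_measure (\<lambda>y. C * f y)"
      using f by simp
    show "AE y in sphere_measure. norm (f y * g y) \<le> norm (C * f y)"
      using C by (intro AE_I2)
        (auto simp: space_sphere_measure abs_mult mult.commute[of C] intro!: mult_left_mono)
  qed measurable
qed

text \<open>An orthogonal map commutes with \<open>sgn\<close> and preserves the norm, so the cone
  over a preimage is the preimage of the cone, and invariance is inherited from
  \<open>lborel\<close>.\<close>

lemma distr_sphere_measure_orthogonal:
  fixes T :: "'a::euclidean_space \<Rightarrow> 'a"
  assumes T: "orthogonal_transformation T"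
  shows "distr sphere_measure sphere_measure T = sphere_measure"
proof (rule measure_eqI)
  let ?B = "cball 0 1 - {0} :: 'a set"
  have lin: "linear T" and norm_T: "norm (T x) = norm x" for x
    using T by (auto simp: orthogonal_transformation)
  have cont: "continuous_on X T" for X
    using lin by (intro linear_continuous_on) (simp add: linear_linear)
  have "T \<in> borel_measurable sphere_measure"
    by (intro measurable_sphere_measure cont)
  then have mT: "T \<in> sphere_measure \<rightarrow>\<^sub>M (sphere_measure :: 'a measure)"
    by (simp cong: measurable_cong_sets add: sets_sphere_measure measurable_restrict_space2_iff
        space_sphere_measure norm_T)
  have sgn_T: "sgn (T x) = T (sgn x)" for x
    by (simp add: sgn_div_norm norm_T linear_scale[OF lin])
  fix A :: "'a set"
  assume "A \<in> sets (distr sphere_measure sphere_measure T)"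
  then have A: "A \<in> sets borel" "A \<subseteq> sphere 0 1" and A': "A \<in> sets sphere_measure"
    by (auto simp: sets_sphere_measure sets_restrict_space)
  have vA: "T -` A \<in> sets borel"
    using measurable_sets_borel[OF borel_measurable_continuous_onI[OF cont] A(1)] by simp
  have vA': "T -` A \<subseteq> sphere 0 1"
    using A(2) by (auto simp: norm_T dest: subsetD)
  have T0: "T x = 0 \<longleftrightarrow> x = 0" for x
    by (metis norm_T norm_eq_zero)
  have pre: "{x \<in> ?B. sgn x \<in> T -` A} = T -` {x \<in> ?B. sgn x \<in> A}"
    by (auto simp: norm_T sgn_T T0)
  have "sgn \<in> borel_measurable (borel :: 'a measure)"
    unfolding sgn_div_norm[abs_def] by measurable
  from measurable_sets_borel[OF this A(1)]
  have "{x \<in> ?B. sgn x \<in> A} = ?B \<inter> sgn -` A" "?B \<inter> sgn -` A \<in> sets borel"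
    by auto
  then have "{x \<in> ?B. sgn x \<in> A} \<in> sets borel" by metis
  then have "emeasure lborel (T -` {x \<in> ?B. sgn x \<in> A}) = emeasure lborel {x \<in> ?B. sgn x \<in> A}"
    by (rule emeasure_lborel_vimage_orthogonal[OF T])
  then have "emeasure surface_measure (T -` A) = emeasure surface_measure A"
    by (simp only: emeasure_surface_measure[OF A] emeasure_surface_measure[OF vA vA'] pre)
  moreover have "emeasure (distr sphere_measure sphere_measure T) A =
      emeasure sphere_measure (T -` A \<inter> space sphere_measure)"
    by (rule emeasure_distr[OF mT A'])
  moreover have "T -` A \<inter> space sphere_measure = T -` A"
    using vA' by (auto simp: space_sphere_measure)
  ultimately show "emeasure (distr sphere_measure sphere_measure T) A = emeasure sphere_measure A"
    by (simp add: sphere_measure_def)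
qed simp

lemma sphere_integral_orthogonal:
  fixes T :: "'a::euclidean_space \<Rightarrow> 'a" and g :: "'a \<Rightarrow> real"
  assumes T: "orthogonal_transformation T" and g: "continuous_on (sphere 0 1) g"
  shows "(LINT y|sphere_measure. g (T y)) = (LINT y|sphere_measure. g y)"
proof -
  have norm_T: "norm (T x) = norm x" for x
    using T by (auto simp: orthogonal_transformation)
  have "T \<in> borel_measurable sphere_measure"
    using T by (intro measurable_sphere_measure linear_continuous_on)
      (simp add: orthogonal_transformation_linear linear_linear)
  then have mT: "T \<in> sphere_measure \<rightarrow>\<^sub>M (sphere_measure :: 'a measure)"
    by (simp cong: measurable_cong_sets add: sets_sphere_measure measurable_restrict_space2_iff
        space_sphere_measure norm_T)
  have "(LINT y|sphere_measure. g y) = (LINT y|distr sphere_measure sphere_measure T. g y)"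
    by (simp only: distr_sphere_measure_orthogonal[OF T])
  also have "\<dots> = (LINT y|sphere_measure. g (T y))"
    by (rule integral_distr[OF mT measurable_sphere_measure[OF g]])
  finally show ?thesis ..
qed

text \<open>The integral of \<open>g\<close> after rotation by the angle \<theta> in the plane of
  \<open>i\<close> and \<open>j\<close> does not depend on \<theta>. Its derivative at 0, taken
  under the integral by dominated convergence, is the integral of the derivative of \<open>g\<close>
  along the rotation field.\<close>

lemma sphere_integral_rotation:
  fixes g :: "'a::euclidean_space \<Rightarrow> real" and D :: "'a \<Rightarrow> 'a"
  assumes i: "i \<in> Basis" and j: "j \<in> Basis" and ij: "i \<noteq> j"
    and g: "\<And>y. (g has_derivative (\<lambda>v. D y \<bullet> v)) (at y)" and D: "continuous_on UNIV D"
  shows "(LINT y|sphere_measure. (y \<bullet> i) * (D y \<bullet> j) - (y \<bullet> j) * (D y \<bullet> i)) = 0"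
proof -
  define rot where "rot \<theta> y = y + ((cos \<theta> - 1) * (y \<bullet> i) - sin \<theta> * (y \<bullet> j)) *\<^sub>R i
    + ((cos \<theta> - 1) * (y \<bullet> j) + sin \<theta> * (y \<bullet> i)) *\<^sub>R j" for \<theta> and y :: 'a
  define vel where "vel \<theta> y = (- sin \<theta> * (y \<bullet> i) - cos \<theta> * (y \<bullet> j)) *\<^sub>R i
    + (- sin \<theta> * (y \<bullet> j) + cos \<theta> * (y \<bullet> i)) *\<^sub>R j" for \<theta> and y :: 'a
  have basis: "i \<bullet> i = 1" "j \<bullet> j = 1" "i \<bullet> j = 0" "j \<bullet> i = 0" "norm i = 1" "norm j = 1"
    using i j ij by (auto simp: inner_Basis)
  have rot_orthogonal: "orthogonal_transformation (rot \<theta>)" for \<theta>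
    unfolding orthogonal_transformation_def
  proof
    show "linear (rot \<theta>)"
      by (rule linearI) (simp_all add: rot_def inner_simps algebra_simps)
    show "\<forall>v w. rot \<theta> v \<bullet> rot \<theta> w = v \<bullet> w"
    proof (intro allI)
      fix v w
      have "cos \<theta> * cos \<theta> + sin \<theta> * sin \<theta> = 1"
        using sin_cos_squared_add[of \<theta>] by (simp add: power2_eq_square add.commute)
      then show "rot \<theta> v \<bullet> rot \<theta> w = v \<bullet> w"
        unfolding rot_def inner_add_left inner_add_right inner_scaleR_left inner_scaleR_right basis
          inner_commute[of i w] inner_commute[of j w]
        by algebra
    qed
  qed
  have rot0: "rot 0 y = y" for y
    by (simp add: rot_def)
  have deriv: "((\<lambda>\<theta>. g (rot \<theta> y)) has_real_derivative D (rot \<theta> y) \<bullet> vel \<theta> y) (at \<theta>)" for \<theta> y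
  proof -
    have "((\<lambda>\<theta>. rot \<theta> y) has_vector_derivative vel \<theta> y) (at \<theta>)"
      unfolding rot_def vel_def by (auto intro!: derivative_eq_intros simp: algebra_simps)
    from vector_derivative_diff_chain_within[OF this, of g] g
    show ?thesis
      unfolding has_real_derivative_iff_has_vector_derivative o_def by (metis UNIV_I has_derivative_at_withinI)
  qed
  obtain K where K: "\<And>y. y \<in> sphere 0 1 \<Longrightarrow> norm (D y) \<le> K" "K \<ge> 0"
    using bounded_on_sphere[of D] D continuous_on_subset by blast
  have in_sphere: "rot \<theta> y \<in> sphere 0 1" if "y \<in> sphere 0 1" for \<theta> y
    using that rot_orthogonal[of \<theta>] by (auto simp: orthogonal_transformation)
  \<comment> \<open>The velocity consists of four products of numbers in \<open>{-1..1}\<close>,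
    hence the constant 4. The bound dominates the difference quotients.\<close>
  have lipschitz: "\<bar>g (rot \<theta> y) - g y\<bar> \<le> K * 4 * \<bar>\<theta>\<bar>" if y: "y \<in> sphere 0 1" for \<theta> y
  proof -
    have vel: "norm (vel \<theta> y) \<le> 4" for \<theta>
    proof -
      have yi: "\<bar>y \<bullet> i\<bar> \<le> 1" "\<bar>y \<bullet> j\<bar> \<le> 1"
        using Basis_le_norm[OF i, of y] Basis_le_norm[OF j, of y] y by auto
      have prod: "\<bar>a * b\<bar> \<le> 1" if "\<bar>a\<bar> \<le> 1" "\<bar>b\<bar> \<le> 1" for a b :: real
        using that by (simp add: abs_mult mult_le_one)
      have "norm (vel \<theta> y) \<le> \<bar>- sin \<theta> * (y \<bullet> i) - cos \<theta> * (y \<bullet> j)\<bar> + \<bar>- sin \<theta> * (y \<bullet> j) + cos \<theta> * (y \<bullet> i)\<bar>"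
        unfolding vel_def by (rule order_trans[OF norm_triangle_ineq]) (simp add: basis)
      also have "\<dots> \<le> 4"
        using prod[of "sin \<theta>" "y \<bullet> i"] prod[of "cos \<theta>" "y \<bullet> i"] prod[of "sin \<theta>" "y \<bullet> j"]
          prod[of "cos \<theta>" "y \<bullet> j"] yi by simp
      finally show ?thesis .
    qed
    have "norm (g (rot \<theta> y) - g (rot 0 y)) \<le> (K * 4) * norm (\<theta> - 0)"
    proof (rule field_differentiable_bound[where S = UNIV])
      fix \<phi> :: real
      have "norm (D (rot \<phi> y) \<bullet> vel \<phi> y) \<le> norm (D (rot \<phi> y)) * norm (vel \<phi> y)"
        by (simp add: Cauchy_Schwarz_ineq2)
      also have "\<dots> \<le> K * 4"
        using K in_sphere[OF y] vel by (intro mult_mono) auto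
      finally show "norm (D (rot \<phi> y) \<bullet> vel \<phi> y) \<le> K * 4" .
    qed (use deriv in \<open>auto\<close>)
    then show ?thesis by (simp add: rot0)
  qed
  have cont_g: "continuous_on X g" for X
    using g by (meson has_derivative_continuous continuous_at_imp_continuous_on)
  have cont_rot: "continuous_on X (rot \<theta>)" for X \<theta>
    using rot_orthogonal by (intro linear_continuous_on) (simp add: orthogonal_transformation_linear linear_linear)
  \<comment> \<open>The difference quotient at the angle \<open>1 / (n + 1)\<close>, a sequence
    tending to 0 without meeting it.\<close>
  define q where "q n y = (g (rot (1 / real (Suc n)) y) - g y) * real (Suc n)" for n y
  have "(\<lambda>n. LINT y|sphere_measure. q n y) \<longlonglongrightarrow> (LINT y|sphere_measure. D y \<bullet> vel 0 y)"
  proof (rule integral_dominated_convergence[where w = "\<lambda>_. K * 4"])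
    show "(\<lambda>y. D y \<bullet> vel 0 y) \<in> borel_measurable sphere_measure"
      unfolding vel_def
      by (intro measurable_sphere_measure continuous_intros continuous_on_subset[OF D]) auto
    show "q n \<in> borel_measurable sphere_measure" for n
      unfolding q_def
      by (intro measurable_sphere_measure continuous_intros cont_g continuous_on_compose2[OF cont_g cont_rot]) auto
    show "integrable sphere_measure (\<lambda>_::'a. K * 4)"
      by (intro integrable_sphere_measure continuous_intros)
    show "AE y in sphere_measure. (\<lambda>n. q n y) \<longlonglongrightarrow> D y \<bullet> vel 0 y"
    proof (rule AE_I2)
      fix y :: 'a
      have "((\<lambda>\<theta>. (g (rot \<theta> y) - g y) / \<theta>) \<longlongrightarrow> D y \<bullet> vel 0 y) (at 0)"
        using deriv[of y 0] by (simp add: DERIV_def rot0)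
      moreover have "filterlim (\<lambda>n. 1 / real (Suc n)) (at 0) sequentially"
        unfolding filterlim_at using LIMSEQ_inverse_real_of_nat
        by (simp add: inverse_eq_divide)
      ultimately show "(\<lambda>n. q n y) \<longlonglongrightarrow> D y \<bullet> vel 0 y"
        unfolding q_def by (auto dest: filterlim_compose)
    qed
    show "AE y in sphere_measure. norm (q n y) \<le> K * 4" for n
    proof (rule AE_I2)
      fix y :: 'a
      assume "y \<in> space sphere_measure"
      then have "\<bar>g (rot (1 / real (Suc n)) y) - g y\<bar> * real (Suc n) \<le> K * 4 * \<bar>1 / real (Suc n)\<bar> * real (Suc n)"
        by (intro mult_right_mono lipschitz) (auto simp: space_sphere_measure)
      then show "norm (q n y) \<le> K * 4"
        by (simp add: q_def abs_mult)
    qed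
  qed
  moreover have "(LINT y|sphere_measure. q n y) = 0" for n
  proof -
    have "integrable sphere_measure (\<lambda>y. g (rot (1 / real (Suc n)) y))"
      by (intro integrable_sphere_measure continuous_on_compose2[OF cont_g cont_rot]) auto
    moreover have "integrable sphere_measure g"
      by (intro integrable_sphere_measure cont_g)
    ultimately show ?thesis
      using sphere_integral_orthogonal[OF rot_orthogonal cont_g] by (simp add: q_def)
  qed
  ultimately have "(LINT y|sphere_measure. D y \<bullet> vel 0 y) = 0"
    by (simp add: LIMSEQ_const_iff)
  then show ?thesis
    by (simp add: vel_def inner_simps algebra_simps)
qed

text \<open>The divergence theorem for the tangential field \<open>x - (x \<bullet> y) y\<close>, which is the combination
  of the rotation fields of the coordinate planes with coefficients \<open>(x \<bullet> j) (y \<bullet> i)\<close>.\<close>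

lemma sphere_integral_tangential:
  fixes g :: "'a::euclidean_space \<Rightarrow> real" and D :: "'a \<Rightarrow> 'a"
  assumes g: "\<And>y. (g has_derivative (\<lambda>v. D y \<bullet> v)) (at y)" and D: "continuous_on UNIV D"
  shows "(LINT y|sphere_measure. D y \<bullet> x - (x \<bullet> y) * (D y \<bullet> y) - (real DIM('a) - 1) * (x \<bullet> y) * g y) = 0"
proof -
  have cont_g: "continuous_on X g" for X
    using g by (meson has_derivative_continuous continuous_at_imp_continuous_on)
  note cont = continuous_intros cont_g continuous_on_subset[OF D]
  \<comment> \<open>Off the diagonal this is the derivative of
    \<open>(x \<bullet> j) * (y \<bullet> i) * g y\<close> along the rotation in the plane of
    \<open>i\<close> and \<open>j\<close>; the last summand comes from differentiating
    \<open>y \<bullet> i\<close>.\<close>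
  define F where "F i j y = (if i = j then 0 else (x \<bullet> j) * 
     ((y \<bullet> i) * ((y \<bullet> i) * (D y \<bullet> j) - (y \<bullet> j) * (D y \<bullet> i)) - (y \<bullet> j) * g y))" for i j y
  have F: "integrable sphere_measure (F i j)" "(LINT y|sphere_measure. F i j y) = 0"
    if ij: "i \<in> Basis" "j \<in> Basis" for i j
  proof -
    show "integrable sphere_measure (F i j)"
      unfolding F_def by (cases "i = j") (auto intro!: integrable_sphere_measure cont)
    have "(LINT y|sphere_measure. F i j y) = 0" if "i \<noteq> j"
    proof -
      have "((\<lambda>y. (x \<bullet> j) * ((y \<bullet> i) * g y)) has_derivative
          (\<lambda>v. (x \<bullet> j) *\<^sub>R ((y \<bullet> i) *\<^sub>R D y + g y *\<^sub>R i) \<bullet> v)) (at y)" for y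
        by (auto intro!: derivative_eq_intros g simp: inner_simps inner_commute[of i] algebra_simps)
      from sphere_integral_rotation[OF ij that this]
      show ?thesis
        using that ij
        by (simp add: F_def inner_simps inner_Basis cont algebra_simps)
    qed
    then show "(LINT y|sphere_measure. F i j y) = 0"
      by (cases "i = j") (simp_all add: F_def)
  qed
  have "(LINT y|sphere_measure. (\<Sum>i\<in>Basis. \<Sum>j\<in>Basis. F i j y)) = 0"
    using F by (simp add: integral_sum)
  moreover have "(\<Sum>i\<in>Basis. \<Sum>j\<in>Basis. F i j y) =
      D y \<bullet> x - (x \<bullet> y) * (D y \<bullet> y) - (real DIM('a) - 1) * (x \<bullet> y) * g y"
    if "y \<in> sphere 0 1" for y
  proof -
    \<comment> \<open>The formula of the case \<open>i \<noteq> j\<close> would leave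
      \<open>- (x \<bullet> j) * (y \<bullet> j) * g y\<close> on the diagonal. Compensating for it
      turns the factor \<open>DIM('a)\<close> into \<open>DIM('a) - 1\<close>.\<close>
    have "F i j y = (x \<bullet> j) * (D y \<bullet> j) * ((y \<bullet> i) * (y \<bullet> i)) - ((x \<bullet> j) * (y \<bullet> j)) * ((D y \<bullet> i) * (y \<bullet> i))
        - (x \<bullet> j) * (y \<bullet> j) * g y + (if i = j then (x \<bullet> j) * (y \<bullet> j) * g y else 0)" for i j
      by (simp add: F_def algebra_simps)
    then have "(\<Sum>i\<in>Basis. \<Sum>j\<in>Basis. F i j y) =
      (\<Sum>j\<in>Basis. (x \<bullet> j) * (D y \<bullet> j)) * (\<Sum>i\<in>Basis. (y \<bullet> i) * (y \<bullet> i))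
      - (\<Sum>j\<in>Basis. (x \<bullet> j) * (y \<bullet> j)) * (\<Sum>i\<in>Basis. (D y \<bullet> i) * (y \<bullet> i))
      - real DIM('a) * ((\<Sum>j\<in>Basis. (x \<bullet> j) * (y \<bullet> j)) * g y) + (\<Sum>j\<in>Basis. (x \<bullet> j) * (y \<bullet> j)) * g y"
      by (simp add: sum.distrib sum_subtractf sum_distrib_left sum_distrib_right mult_ac)
         (rule sum.swap)
    also have "\<dots> = (x \<bullet> D y) * (y \<bullet> y) - (x \<bullet> y) * (D y \<bullet> y) - real DIM('a) * ((x \<bullet> y) * g y) + (x \<bullet> y) * g y"
      by (simp only: euclidean_inner[symmetric])
    also have "y \<bullet> y = 1"
      using that by (simp add: norm_eq_1[symmetric])
    finally show ?thesis
      by (simp add: inner_commute algebra_simps)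
  qed
  ultimately show ?thesis
    by (subst Bochner_Integration.integral_cong[OF refl, symmetric]) (auto simp: space_sphere_measure)
qed

subsection \<open>The reproducing property of zonal polynomials\<close>

text \<open>The convolution of two zonal functions. Their profiles are of type \<open>poly\<close>,
  so that integration by parts becomes an identity between formal derivatives.\<close>

definition zonal_integral :: "'a::euclidean_space \<Rightarrow> 'a \<Rightarrow> real poly \<Rightarrow> real poly \<Rightarrow> real" where
  "zonal_integral x z P R = (LINT y|sphere_measure. poly P (x \<bullet> y) * poly R (z \<bullet> y))"

lemma integrable_zonal [simp]:
  "integrable sphere_measure (\<lambda>y::'a::euclidean_space. poly P (x \<bullet> y) * poly R (z \<bullet> y))"
  by (intro integrable_sphere_measure continuous_intros)

lemma zonal_integral_linear:
  "zonal_integral x z (P + Q) R = zonal_integral x z P R + zonal_integral x z Q R"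
  "zonal_integral x z (P - Q) R = zonal_integral x z P R - zonal_integral x z Q R"
  "zonal_integral x z (smult a P) R = a * zonal_integral x z P R"
  "zonal_integral x z P (R + S) = zonal_integral x z P R + zonal_integral x z P S"
  "zonal_integral x z P (R - S) = zonal_integral x z P R - zonal_integral x z P S"
  "zonal_integral x z P (smult a R) = a * zonal_integral x z P R"
  "zonal_integral x z 0 R = 0" "zonal_integral x z P 0 = 0"
  by (simp_all add: zonal_integral_def algebra_simps mult.left_commute[of _ a])

text \<open>Thus \<open>zonal_integral z z 1\<close> acts as a moment functional on polynomials in
  one variable, and the Gegenbauer weight never has to be computed.\<close>

lemma zonal_integral_diag: "zonal_integral z z P R = zonal_integral z z 1 (P * R)"
  by (simp add: zonal_integral_def)

text \<open>This is \<open>sphere_integral_tangential\<close> for the product of the two zonal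
  functions. Along the field \<open>x - (x \<bullet> y) y\<close> the derivative of
  \<open>x \<bullet> y\<close> is \<open>1 - (x \<bullet> y)^2\<close>, and that of
  \<open>z \<bullet> y\<close> is
  \<open>x \<bullet> z - (x \<bullet> y) (z \<bullet> y)\<close>.\<close>

lemma zonal_integral_by_parts:
  fixes x z :: "'a::euclidean_space"
  assumes "norm x = 1" and d: "DIM('a) = d + 1"
  shows "zonal_integral x z ([:1, 0, -1:] * pderiv P) R =
    real d * zonal_integral x z ([:0, 1:] * P) R - (x \<bullet> z) * zonal_integral x z P (pderiv R)
    + zonal_integral x z ([:0, 1:] * P) ([:0, 1:] * pderiv R)"
proof -
  define D where "D y = (poly (pderiv P) (x \<bullet> y) * poly R (z \<bullet> y)) *\<^sub>R x
    + (poly P (x \<bullet> y) * poly (pderiv R) (z \<bullet> y)) *\<^sub>R z" for y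
  have chain: "((\<lambda>y. poly Q (v \<bullet> y)) has_derivative (\<lambda>w. poly (pderiv Q) (v \<bullet> y) * (v \<bullet> w))) (at y)"
    for Q and v y :: 'a
    by (rule has_derivative_eq_rhs[OF has_derivative_compose[OF _ poly_DERIV[THEN has_field_derivative_imp_has_derivative]]])
       (auto intro!: derivative_eq_intros)
  have "((\<lambda>y. poly P (x \<bullet> y) * poly R (z \<bullet> y)) has_derivative (\<lambda>v. D y \<bullet> v)) (at y)" for y
    by (rule has_derivative_eq_rhs[OF has_derivative_mult[OF chain chain]])
       (auto simp: D_def inner_simps algebra_simps)
  moreover have "continuous_on UNIV D"
    unfolding D_def by (intro continuous_intros)
  ultimately have "(LINT y|sphere_measure. D y \<bullet> x - (x \<bullet> y) * (D y \<bullet> y)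
      - (real DIM('a) - 1) * (x \<bullet> y) * (poly P (x \<bullet> y) * poly R (z \<bullet> y))) = 0"
    by (rule sphere_integral_tangential)
  moreover have "D y \<bullet> x - (x \<bullet> y) * (D y \<bullet> y) - (real DIM('a) - 1) * (x \<bullet> y) * (poly P (x \<bullet> y) * poly R (z \<bullet> y)) =
    poly ([:1, 0, -1:] * pderiv P) (x \<bullet> y) * poly R (z \<bullet> y)
    + (x \<bullet> z) * (poly P (x \<bullet> y) * poly (pderiv R) (z \<bullet> y))
    - poly ([:0, 1:] * P) (x \<bullet> y) * poly ([:0, 1:] * pderiv R) (z \<bullet> y)
    - real d * (poly ([:0, 1:] * P) (x \<bullet> y) * poly R (z \<bullet> y))" for y
    using \<open>norm x = 1\<close> by (simp add: D_def d inner_simps norm_eq_1 inner_commute[of z x] algebra_simps)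
  ultimately show ?thesis
    by (simp add: zonal_integral_def
        del: poly_mult poly_pCons mult_pCons_left mult_pCons_right)
qed

text \<open>Symmetry of the Gegenbauer operator: integrating \<open>Q * pderiv P\<close> by parts
  against the constant 1 moves the derivative from \<open>Q\<close> and completes the operator
  applied to \<open>P\<close>.\<close>

lemma zonal_moment_eigen:
  fixes z :: "'a::euclidean_space"
  assumes z: "norm z = 1" "DIM('a) = d + 1"
    and eig: "gegenbauer_operator (real d) P = smult (-\<mu>) P"
  shows "zonal_integral z z 1 ([:1, 0, -1:] * pderiv Q * pderiv P) = \<mu> * zonal_integral z z 1 (Q * P)"
proof -
  have "[:1, 0, -1:] * pderiv Q * pderiv P =
    [:1, 0, -1:] * pderiv (Q * pderiv P) - smult (real d) ([:0, 1:] * (Q * pderiv P))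
      - Q * gegenbauer_operator (real d) P"
    by (rule poly_eq_by_eval) (simp add: gegenbauer_operator_def pderiv_mult algebra_simps)
  also have "zonal_integral z z 1 \<dots> = \<mu> * zonal_integral z z 1 (Q * P)"
    using zonal_integral_by_parts[OF z, of z "Q * pderiv P" 1]
    by (simp add: eig zonal_integral_linear zonal_integral_diag[of z "_ * _" 1] pderiv_1
        del: mult_pCons_left mult_pCons_right)
  finally show ?thesis .
qed

text \<open>The left-hand side of \<open>zonal_moment_eigen\<close> is symmetric in the two
  polynomials, and their eigenvalues differ.\<close>

lemma gegenbauer_orthogonal:
  fixes z :: "'a::euclidean_space"
  assumes z: "norm z = 1" "DIM('a) = d + 1" and d: "d \<ge> 2" and "l \<noteq> m"
  shows "zonal_integral z z 1 (gegenbauer_poly d l * gegenbauer_poly d m) = 0"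
proof -
  let ?I = "zonal_integral z z 1 (gegenbauer_poly d l * gegenbauer_poly d m)"
  have "(real m * (real m + real d - 1)) * ?I = (real l * (real l + real d - 1)) * ?I"
    using zonal_moment_eigen[OF z gegenbauer_poly_eigen, of "gegenbauer_poly d l" m]
      zonal_moment_eigen[OF z gegenbauer_poly_eigen, of "gegenbauer_poly d m" l]
    by (simp add: mult.commute[of "gegenbauer_poly d m"] mult.assoc
        mult.commute[of "pderiv (gegenbauer_poly d m)"] del: mult_pCons_left mult_pCons_right)
  then have "(real m - real l) * (real m + real l + real d - 1) * ?I = 0"
    by (simp add: algebra_simps)
  then show ?thesis
    using \<open>l \<noteq> m\<close> d by auto
qed

text \<open>The mixed moment \<open>m\<close> is evaluated twice, expanding \<open>t\<close> times
  either factor by the three-term recurrence. Orthogonality leaves one squared norm each time, and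
  the resulting ratio is that of \<open>harmonic_dim_Suc\<close>; the start is the total mass
  1.\<close>

lemma gegenbauer_norm:
  fixes z :: "'a::euclidean_space"
  assumes z: "norm z = 1" "DIM('a) = d + 1" and d: "d \<ge> 2"
  shows "zonal_integral z z 1 (gegenbauer_poly d l * gegenbauer_poly d l) = 1 / harmonic_dim d l"
proof (induction l)
  case 0
  show ?case
    by (simp add: gegenbauer_poly_0[OF d] harmonic_dim_0[OF d] zonal_integral_def)
next
  case (Suc l)
  let ?M = "zonal_integral z z 1" and ?G = "gegenbauer_poly d"
  note orth = gegenbauer_orthogonal[OF z d]
  define m where "m = ?M ([:0, 1:] * ?G l * ?G (Suc l))"
  have "?M (smult (2 * real l + real d - 1) ([:0, 1:] * ?G l) * ?G (Suc l)) =
      (real l + real d - 1) * ?M (?G (Suc l) * ?G (Suc l))"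
    unfolding gegenbauer_poly_recurrence[OF d]
    by (simp add: distrib_right zonal_integral_linear orth)
  then have up: "(2 * real l + real d - 1) * m = (real l + real d - 1) * ?M (?G (Suc l) * ?G (Suc l))"
    by (simp only: m_def mult_smult_left zonal_integral_linear)
  have "?M (smult (2 * real (Suc l) + real d - 1) ([:0, 1:] * ?G (Suc l)) * ?G l) =
      (real l + 1) * ?M (?G l * ?G l)"
    unfolding gegenbauer_poly_recurrence[OF d]
    by (simp add: distrib_right zonal_integral_linear orth)
  moreover have "([:0, 1:] * ?G (Suc l)) * ?G l = [:0, 1:] * ?G l * ?G (Suc l)"
    by (simp only: mult_ac)
  ultimately have "(2 * real (Suc l) + real d - 1) * m = (real l + 1) * ?M (?G l * ?G l)"
    by (simp only: m_def mult_smult_left zonal_integral_linear)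
  then have "(2 * real l + real d + 1) * m = (real l + 1) * ?M (?G l * ?G l)"
    by (simp add: add_ac)
  with up have "(2 * real l + real d + 1) * (real l + real d - 1) * ?M (?G (Suc l) * ?G (Suc l)) =
      (2 * real l + real d - 1) * (real l + 1) * ?M (?G l * ?G l)"
    by algebra
  then have "(2 * real l + real d + 1) * (real l + real d - 1) * harmonic_dim d l * ?M (?G (Suc l) * ?G (Suc l)) =
      (2 * real l + real d - 1) * (real l + 1)"
    using Suc.IH harmonic_dim_pos[OF d, of l] by (simp add: field_simps)
  then have "(2 * real l + real d - 1) * (real l + 1) * (harmonic_dim d (Suc l) * ?M (?G (Suc l) * ?G (Suc l))) =
      (2 * real l + real d - 1) * (real l + 1) * 1"
    using harmonic_dim_Suc[OF d, of l] by (metis (no_types, opaque_lifting) mult.assoc mult_1_right)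
  then have "harmonic_dim d (Suc l) * ?M (?G (Suc l) * ?G (Suc l)) = 1"
    unfolding mult_cancel_left using d by auto
  then show ?case
    using harmonic_dim_pos[OF d, of "Suc l"] by (simp add: field_simps)
qed

text \<open>For a monomial \<open>R\<close> the product of \<open>t\<close> and its derivative is
  again a multiple of \<open>R\<close>. Integration by parts with the raising relation therefore
  involves only one extra unknown \<open>s\<close>, which the three-term recurrence
  eliminates.\<close>

lemma zonal_integral_recurrence:
  fixes x z :: "'a::euclidean_space"
  assumes x: "norm x = 1" "DIM('a) = d + 1" and d: "d \<ge> 2"
  defines "Z \<equiv> \<lambda>l n. zonal_integral x z (gegenbauer_poly d l) (monom 1 n)"
  shows "(real l + real d - 1) * (real l + real d + real n) * Z (Suc l) n =
    real l * (real l - 1 - real n) * Z (l - 1) n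
    + (x \<bullet> z) * real n * (2 * real l + real d - 1) * Z l (n - 1)"
proof -
  let ?G = "gegenbauer_poly d"
  have pow: "pderiv (monom 1 n) = smult (real n) (monom 1 (n - 1))"
    by (simp add: smult_monom pderiv_monom)
  have tpow: "[:0, 1:] * pderiv (monom 1 n) = smult (real n) (monom 1 n)"
    unfolding pow by (cases n) (simp_all add: monom_Suc)
  define s where "s = zonal_integral x z ([:0, 1:] * ?G l) (monom 1 n)"
  have "[:1, 0, -1:] * pderiv (?G l) =
      smult (real l + real d - 1) ([:0, 1:] * ?G l) - smult (real l + real d - 1) (?G (Suc l))"
    unfolding gegenbauer_poly_up[OF d] by simp
  then have "(real l + real d - 1) * s - (real l + real d - 1) * Z (Suc l) n =
      real d * s - (x \<bullet> z) * (real n * Z l (n - 1)) + real n * s"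
    using zonal_integral_by_parts[OF x, of z "?G l" "monom 1 n", unfolded tpow, unfolded pow]
    by (simp add: zonal_integral_linear Z_def s_def del: mult_pCons_left mult_pCons_right)
  moreover have "(2 * real l + real d - 1) * s = real l * Z (l - 1) n + (real l + real d - 1) * Z (Suc l) n"
    using arg_cong[OF gegenbauer_poly_recurrence[OF d, of l], of "\<lambda>P. zonal_integral x z P (monom 1 n)"]
    by (simp only: zonal_integral_linear Z_def s_def)
  ultimately show ?thesis
    by algebra
qed

text \<open>The lowering relation is multiplied by the derivative of the monomial, and
  \<open>zonal_moment_eigen\<close> evaluates the term containing two derivatives. This relation
  steps the degree and the power together.\<close>

lemma gegenbauer_moment_Suc:
  fixes z :: "'a::euclidean_space"
  assumes z: "norm z = 1" "DIM('a) = d + 1" and d: "d \<ge> 2"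
  shows "(real l + real d + real n) * zonal_integral z z (gegenbauer_poly d (Suc l)) (monom 1 n) =
    real n * zonal_integral z z (gegenbauer_poly d l) (monom 1 (n - 1))"
proof -
  let ?G = "gegenbauer_poly d" and ?M = "zonal_integral z z 1"
  have pow: "pderiv (monom 1 n) = smult (real n) (monom 1 (n - 1))"
    by (simp add: smult_monom pderiv_monom)
  have tpow: "[:0, 1:] * pderiv (monom 1 n) = smult (real n) (monom 1 n)"
    unfolding pow by (cases n) (simp_all add: monom_Suc)
  have "smult (real l + 1) (?G l * pderiv (monom 1 n)) =
    smult (real l + 1) (?G (Suc l) * ([:0, 1:] * pderiv (monom 1 n)))
    + [:1, 0, -1:] * pderiv (monom 1 n) * pderiv (?G (Suc l))"
    using arg_cong[OF gegenbauer_poly_down[OF d, of l], of "\<lambda>P. P * pderiv (monom 1 n)"]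
    by (simp add: algebra_simps del: mult_pCons_left mult_pCons_right)
  then have "?M (smult (real l + 1) (?G l * pderiv (monom 1 n))) =
    ?M (smult (real l + 1) (?G (Suc l) * ([:0, 1:] * pderiv (monom 1 n)))
    + [:1, 0, -1:] * pderiv (monom 1 n) * pderiv (?G (Suc l)))"
    by simp
  then have "(real l + 1) * (real n * ?M (?G l * monom 1 (n - 1))) =
    (real l + 1) * ((real l + real d + real n) * ?M (?G (Suc l) * monom 1 n))"
    unfolding zonal_integral_linear(4,6) zonal_moment_eigen[OF z gegenbauer_poly_eigen] tpow
    unfolding pow
    by (simp add: zonal_integral_linear algebra_simps)
  then show ?thesis
    unfolding zonal_integral_diag[of z "?G _"] by auto
qed

text \<open>Both sides satisfy the same recurrence in \<open>l\<close>; that the left-hand side depends only on \<open>x \<bullet> z\<close> is a consequence.\<close>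

lemma funk_hecke_monom:
  fixes x z :: "'a::euclidean_space"
  assumes x: "norm x = 1" and z: "norm z = 1" and D: "DIM('a) = d + 1" and d: "d \<ge> 2"
  shows "zonal_integral x z (gegenbauer_poly d l) (monom 1 n) =
    poly (gegenbauer_poly d l) (x \<bullet> z) * zonal_integral z z (gegenbauer_poly d l) (monom 1 n)"
proof (induction l arbitrary: n rule: less_induct)
  case (less l)
  show ?case
  proof (cases l)
    case 0
    then show ?thesis
      by (simp add: gegenbauer_poly_0[OF d] zonal_integral_def)
  next
    case (Suc k)
    let ?G = "gegenbauer_poly d"
    let ?Z = "\<lambda>l n. zonal_integral x z (?G l) (monom 1 n)"
    let ?M = "\<lambda>l n. zonal_integral z z (?G l) (monom 1 n)"
    let ?c = "x \<bullet> z"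
    have zz: "z \<bullet> z = 1"
      using z by (simp add: norm_eq_1)
    have Z: "(real k + real d - 1) * (real k + real d + real n) * ?Z (Suc k) n =
        real k * (real k - 1 - real n) * (poly (?G (k - 1)) ?c * ?M (k - 1) n)
        + ?c * real n * (2 * real k + real d - 1) * (poly (?G k) ?c * ?M k (n - 1))"
      unfolding zonal_integral_recurrence[OF x D d] using less.IH[of "k - 1"] less.IH[of k] Suc by simp
    have M: "(real k + real d - 1) * (real k + real d + real n) * ?M (Suc k) n =
        real k * (real k - 1 - real n) * ?M (k - 1) n + real n * (2 * real k + real d - 1) * ?M k (n - 1)"
      using zonal_integral_recurrence[OF z D d, of k n z] by (simp add: zz)
    have G: "(2 * real k + real d - 1) * (?c * poly (?G k) ?c) =
        real k * poly (?G (k - 1)) ?c + (real k + real d - 1) * poly (?G (Suc k)) ?c"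
      using arg_cong[OF gegenbauer_poly_recurrence[OF d, of k], of "\<lambda>P. poly P ?c"]
      by (simp add: mult.left_commute)
    note S = gegenbauer_moment_Suc[OF z D d, of k n]
    \<comment> \<open>Expand \<open>?c * poly (?G k) ?c\<close> in \<open>Z\<close> by
      \<open>G\<close>. By \<open>S\<close> the part with \<open>?G (Suc k)\<close> is the claimed
      right-hand side; by \<open>M\<close> and \<open>S\<close> the coefficients of
      \<open>poly (?G (k - 1)) ?c\<close> cancel.\<close>
    have "(real k + real d - 1) * (real k + real d + real n) * ?Z (Suc k) n =
        (real k + real d - 1) * (real k + real d + real n) * (poly (?G (Suc k)) ?c * ?M (Suc k) n)"
      using Z M G S by algebra
    moreover have "(real k + real d - 1) * (real k + real d + real n) \<noteq> 0"
      using d by auto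
    ultimately show ?thesis
      unfolding Suc mult_cancel_left by blast
  qed
qed

lemma funk_hecke:
  fixes x z :: "'a::euclidean_space"
  assumes "norm x = 1" "norm z = 1" "DIM('a) = d + 1" "d \<ge> 2"
  shows "zonal_integral x z (gegenbauer_poly d l) R =
    poly (gegenbauer_poly d l) (x \<bullet> z) * zonal_integral z z (gegenbauer_poly d l) R"
proof -
  have "zonal_integral x z (gegenbauer_poly d l) (\<Sum>i\<in>A. monom (a i) i) =
    poly (gegenbauer_poly d l) (x \<bullet> z) * zonal_integral z z (gegenbauer_poly d l) (\<Sum>i\<in>A. monom (a i) i)"
    for a :: "nat \<Rightarrow> real" and A :: "nat set"
  proof (induction A rule: infinite_finite_induct)
    case (insert i A)
    have "monom (a i) i = smult (a i) (monom 1 i)"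
      by (simp add: smult_monom)
    with insert show ?case
      by (simp add: zonal_integral_linear funk_hecke_monom[OF assms] algebra_simps)
  qed (simp_all add: zonal_integral_linear)
  from this[of "coeff R" "{..degree R}"] show ?thesis
    by (simp add: poly_as_sum_of_monoms)
qed

text \<open>Funk-Hecke reduces two poles to one, where orthogonality and the norm give the
  value.\<close>

lemma gegenbauer_reproducing:
  fixes x z :: "'a::euclidean_space"
  assumes x: "norm x = 1" and z: "norm z = 1" and D: "DIM('a) = d + 1" and d: "d \<ge> 2"
  shows "zonal_integral x z (gegenbauer_poly d l) (gegenbauer_poly d m) =
    (if l = m then poly (gegenbauer_poly d l) (x \<bullet> z) / harmonic_dim d l else 0)"
  unfolding funk_hecke[OF assms] zonal_integral_diag[of z "gegenbauer_poly d l"]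
  using gegenbauer_orthogonal[OF z D d, of l m] gegenbauer_norm[OF z D d, of l] by auto

subsection \<open>Needlets\<close>

lemma polynomial_degree_le_monomial:
  fixes \<alpha> :: "'n::finite \<Rightarrow> nat"
  assumes "(\<Sum>i\<in>UNIV. \<alpha> i) \<le> \<nu>"
  shows "polynomial_degree_le \<nu> (\<lambda>x :: real^'n. \<Prod>i\<in>UNIV. (x $ i) ^ \<alpha> i)"
  unfolding polynomial_degree_le_def
proof (intro exI allI)
  fix x :: "real^'n"
  show "(\<Prod>i\<in>UNIV. (x $ i) ^ \<alpha> i) =
      (\<Sum>\<beta> | (\<Sum>i\<in>UNIV. \<beta> i) \<le> \<nu>. (if \<beta> = \<alpha> then 1 else 0) * (\<Prod>i\<in>UNIV. (x $ i) ^ \<beta> i))"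
    using assms by (subst sum.remove[OF finite_multi_indices, of \<alpha>]) (auto intro!: sum.neutral)
qed

lemma polynomial_degree_le_add:
  assumes "polynomial_degree_le \<nu> q" "polynomial_degree_le \<nu> r"
  shows "polynomial_degree_le \<nu> (\<lambda>x. q x + r x)"
proof -
  obtain c c' where
    "q x = (\<Sum>\<alpha> | (\<Sum>i\<in>UNIV. \<alpha> i) \<le> \<nu>. c \<alpha> * (\<Prod>i\<in>UNIV. (x $ i) ^ \<alpha> i))"
    "r x = (\<Sum>\<alpha> | (\<Sum>i\<in>UNIV. \<alpha> i) \<le> \<nu>. c' \<alpha> * (\<Prod>i\<in>UNIV. (x $ i) ^ \<alpha> i))" for x
    using assms unfolding polynomial_degree_le_def by blast
  then show ?thesis
    unfolding polynomial_degree_le_def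
    by (intro exI[of _ "\<lambda>\<alpha>. c \<alpha> + c' \<alpha>"]) (simp add: distrib_right sum.distrib)
qed

lemma polynomial_degree_le_cmult:
  assumes "polynomial_degree_le \<nu> q"
  shows "polynomial_degree_le \<nu> (\<lambda>x. a * q x)"
proof -
  obtain c where
    "q x = (\<Sum>\<alpha> | (\<Sum>i\<in>UNIV. \<alpha> i) \<le> \<nu>. c \<alpha> * (\<Prod>i\<in>UNIV. (x $ i) ^ \<alpha> i))" for x
    using assms unfolding polynomial_degree_le_def by blast
  then show ?thesis
    unfolding polynomial_degree_le_def
    by (intro exI[of _ "\<lambda>\<alpha>. a * c \<alpha>"]) (simp add: sum_distrib_left mult.assoc)
qed

lemma polynomial_degree_le_sum:
  assumes "\<And>a. a \<in> A \<Longrightarrow> polynomial_degree_le \<nu> (q a)"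
  shows "polynomial_degree_le \<nu> (\<lambda>x. \<Sum>a\<in>A. q a x)"
  using assms
proof (induction A rule: infinite_finite_induct)
  case (insert a A)
  then show ?case by (simp add: polynomial_degree_le_add)
qed (auto simp: polynomial_degree_le_def intro!: exI[of _ "\<lambda>_. 0"])

lemma polynomial_degree_le_mult:
  assumes "polynomial_degree_le \<mu> q" "polynomial_degree_le \<nu> r"
  shows "polynomial_degree_le (\<mu> + \<nu>) (\<lambda>x :: real^'n. q x * r x)"
proof -
  obtain c c' where
    "q x = (\<Sum>\<alpha> | (\<Sum>i\<in>UNIV. \<alpha> i) \<le> \<mu>. c \<alpha> * (\<Prod>i\<in>UNIV. (x $ i) ^ \<alpha> i))"
    "r x = (\<Sum>\<alpha> | (\<Sum>i\<in>UNIV. \<alpha> i) \<le> \<nu>. c' \<alpha> * (\<Prod>i\<in>UNIV. (x $ i) ^ \<alpha> i))" for x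
    using assms unfolding polynomial_degree_le_def by blast
  then have "(\<lambda>x. q x * r x) =
      (\<lambda>x. \<Sum>\<alpha> | (\<Sum>i\<in>UNIV. \<alpha> i) \<le> \<mu>. \<Sum>\<beta> | (\<Sum>i\<in>UNIV. \<beta> i) \<le> \<nu>.
        (c \<alpha> * c' \<beta>) * (\<Prod>i\<in>UNIV. (x $ i) ^ (\<alpha> i + \<beta> i)))"
    by (simp only: sum_product) (simp add: power_add prod.distrib mult_ac)
  then show ?thesis
    by (auto simp: sum.distrib
        intro!: polynomial_degree_le_sum polynomial_degree_le_cmult polynomial_degree_le_monomial)
qed

lemma polynomial_degree_le_const: "polynomial_degree_le \<nu> (\<lambda>x :: real^'n. a)"
  using polynomial_degree_le_cmult[OF polynomial_degree_le_monomial[of "\<lambda>_ :: 'n. 0" \<nu>], of a] by simp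

text \<open>The constant 1 has degree at most \<open>\<nu> - \<mu>\<close>, so this is a case of the
  product rule.\<close>

lemma polynomial_degree_le_mono:
  assumes "polynomial_degree_le \<mu> q" "\<mu> \<le> \<nu>"
  shows "polynomial_degree_le \<nu> q"
  using polynomial_degree_le_mult[OF assms(1) polynomial_degree_le_const[of "\<nu> - \<mu>" 1]] assms(2) by simp

lemma polynomial_degree_le_inner: "polynomial_degree_le 1 (\<lambda>x :: real^'n. v \<bullet> x)"
proof -
  have "polynomial_degree_le 1 (\<lambda>x :: real^'n. x $ k)" for k
    using polynomial_degree_le_monomial[of "\<lambda>i. if i = k then 1 else 0" 1]
    by (simp add: if_distrib[of "power _"] prod.delta cong: if_cong)
  then show ?thesis
    by (auto simp: inner_vec_def intro!: polynomial_degree_le_sum polynomial_degree_le_cmult)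
qed

lemma polynomial_degree_le_power_inner: "polynomial_degree_le n (\<lambda>x :: real^'n. (v \<bullet> x) ^ n)"
proof (induction n)
  case (Suc n)
  then show ?case
    using polynomial_degree_le_mult[OF polynomial_degree_le_inner[of v] Suc] by simp
qed (simp add: polynomial_degree_le_const)

lemma polynomial_degree_le_zonal:
  assumes "degree P \<le> \<nu>"
  shows "polynomial_degree_le \<nu> (\<lambda>x :: real^'n. poly P (v \<bullet> x))"
  unfolding poly_altdef using assms
  by (intro polynomial_degree_le_sum polynomial_degree_le_cmult
      polynomial_degree_le_mono[OF polynomial_degree_le_power_inner]) auto

section \<open>The filters and their kernels\<close>

text \<open>The support gives zeros strictly outside \<open>{1/2..2}\<close>; continuity adds the
  endpoints. The zero at 2 removes the term \<open>l = 2 ^ j\<close> from the level-\<open>j\<close>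
  kernel, whose square would otherwise exceed the exactness of the quadrature.\<close>

lemma needlet_filter_zero:
  assumes h: "needlet_filter h" and t: "0 \<le> t" "t \<le> 1/2 \<or> t \<ge> 2"
  shows "h t = 0"
proof -
  obtain \<kappa> D where \<kappa>: "\<kappa> \<ge> 1" and D0: "\<forall>t\<in>{0..}. D (0::nat) t = h t"
    and D: "\<forall>i<\<kappa>. \<forall>t\<in>{0..}. (D i has_real_derivative D (Suc i) t) (at t within {0..})"
    using h unfolding needlet_filter_def C_k_on_def by blast
  have "continuous_on {0..} (D 0)"
    using D \<kappa> by (intro DERIV_continuous_on[of _ _ "D (Suc 0)"]) auto
  then have cont: "continuous_on {0..} h"
    using D0 continuous_on_cong[of "{0..}" "{0..}" "D 0" h] by auto
  have outside: "h s = 0" if "s \<ge> 0" "s \<notin> {1/2..2}" for s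
    using h that closure_subset[of "{t. t \<ge> 0 \<and> h t \<noteq> 0}"] unfolding needlet_filter_def by auto
  have "h t = 0" if "t \<le> 1/2"
    by (rule continuous_constant_on_closure[of "{0..<1/2}"])
       (use that t outside in \<open>auto intro: continuous_on_subset[OF cont]\<close>)
  moreover have "h t = 0" if "t \<ge> 2"
    by (rule continuous_constant_on_closure[of "{2<..}"])
       (use that t outside in \<open>auto intro: continuous_on_subset[OF cont]\<close>)
  ultimately show ?thesis
    using t by blast
qed

text \<open>The telescoping identity behind the sum over levels: below \<open>1/2\<close> both
  values of \<open>H\<close> are 1 and \<open>h t = 0\<close>, between \<open>1/2\<close> and 1 it
  is the partition property, and from 1 on \<open>h (2 * t) = 0\<close>.\<close>

lemma filter_H_refine:
  assumes h: "needlet_filter h" and "t \<ge> 0"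
  shows "filter_H h t = filter_H h (2 * t) + (h t)\<^sup>2"
proof -
  have "(h t)\<^sup>2 + (h (2 * t))\<^sup>2 = 1" if "1/2 \<le> t" "t \<le> 1"
    using h that unfolding needlet_filter_def by auto
  then show ?thesis
    using needlet_filter_zero[OF h, of t] needlet_filter_zero[OF h, of "2 * t"] \<open>t \<ge> 0\<close>
    by (auto simp: filter_H_def)
qed

text \<open>Coefficients replace the filter, so that convolution squares \<open>a\<close>; the
  length \<open>n\<close> may exceed the true cutoff, so that two levels can be compared at a common
  length.\<close>

definition kernel_poly :: "nat \<Rightarrow> nat \<Rightarrow> (nat \<Rightarrow> real) \<Rightarrow> real poly" where
  "kernel_poly d n a = (\<Sum>l<n. smult (a l * harmonic_dim d l) (gegenbauer_poly d l))"

lemma filtered_kernel_eq_poly: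
  assumes "T \<ge> 1" and "\<And>l. l \<ge> n \<Longrightarrow> g (real l / T) = 0"
  shows "filtered_kernel d T g t = poly (kernel_poly d n (\<lambda>l. g (real l / T))) t"
proof -
  have "(\<Sum>l. g (real l / T) * harmonic_dim d l * gegenbauer_normalized d l t) =
      (\<Sum>l<n. g (real l / T) * harmonic_dim d l * gegenbauer_normalized d l t)"
    using assms(2) by (intro suminf_finite) auto
  then show ?thesis
    using assms(1) by (simp add: filtered_kernel_def kernel_poly_def poly_sum poly_gegenbauer_poly)
qed

lemma degree_kernel_poly: "degree (kernel_poly d n a) \<le> n - 1"
  unfolding kernel_poly_def
  by (intro degree_sum_le degree_smult_le[THEN order_trans] degree_gegenbauer_poly[THEN order_trans]) auto

text \<open>The reproducing property leaves only the diagonal of the double sum and cancels one of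
  its two factors \<open>harmonic_dim d l\<close>.\<close>

lemma kernel_poly_convolution:
  fixes x z :: "'a::euclidean_space"
  assumes "norm x = 1" "norm z = 1" "DIM('a) = d + 1" "d \<ge> 2"
  shows "zonal_integral x z (kernel_poly d n a) (kernel_poly d n a) =
    poly (kernel_poly d n (\<lambda>l. (a l)\<^sup>2)) (x \<bullet> z)"
proof -
  have sum_left: "zonal_integral x z (\<Sum>l\<in>A. P l) R = (\<Sum>l\<in>A. zonal_integral x z (P l) R)"
    and sum_right: "zonal_integral x z R (\<Sum>l\<in>A. P l) = (\<Sum>l\<in>A. zonal_integral x z R (P l))"
    for P R and A :: "nat set"
    by (induction A rule: infinite_finite_induct) (simp_all add: zonal_integral_linear)
  have "zonal_integral x z (kernel_poly d n a) (kernel_poly d n a) =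
    (\<Sum>l<n. \<Sum>m<n. (a l * harmonic_dim d l) * ((a m * harmonic_dim d m) *
      (if l = m then poly (gegenbauer_poly d l) (x \<bullet> z) / harmonic_dim d l else 0)))"
    unfolding kernel_poly_def sum_left zonal_integral_linear sum_right gegenbauer_reproducing[OF assms]
      sum_distrib_left by (intro sum.cong refl) simp
  also have "\<dots> = (\<Sum>l<n. (a l)\<^sup>2 * harmonic_dim d l * poly (gegenbauer_poly d l) (x \<bullet> z))"
  proof (intro sum.cong refl)
    fix l assume "l \<in> {..<n}"
    then show "(\<Sum>m<n. (a l * harmonic_dim d l) * ((a m * harmonic_dim d m) *
      (if l = m then poly (gegenbauer_poly d l) (x \<bullet> z) / harmonic_dim d l else 0))) =
      (a l)\<^sup>2 * harmonic_dim d l * poly (gegenbauer_poly d l) (x \<bullet> z)"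
      using harmonic_dim_pos[OF \<open>d \<ge> 2\<close>, of l]
      by (subst sum.remove[of _ l]) (auto simp: power2_eq_square intro!: sum.neutral)
  qed
  finally show ?thesis
    by (simp add: kernel_poly_def poly_sum)
qed

text \<open>The two factors \<open>sqrt (w j k)\<close> combine to the weight. Once the sum over
  \<open>k\<close> is inside the integral, it is the quadrature of the product of the kernels
  centred at \<open>x\<close> and \<open>y\<close>, exact by \<open>deg\<close>.\<close>

lemma needlet_level_sum:
  fixes f :: "real^'n \<Rightarrow> real" and p :: "nat \<Rightarrow> nat \<Rightarrow> real^'n"
  assumes quad: "needlet_quadrature N w p" and f: "integrable sphere_measure f"
    and kernel: "\<And>t. filtered_kernel d (2 powi (int j - 1)) h t = poly P t"
    and deg: "2 * degree P < 2 ^ (j + 1)"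
  shows "(\<Sum>k=1..N j. sphere_inner f (needlet d h w p j k) * needlet d h w p j k x) =
    (LINT y|sphere_measure. f y * zonal_integral x y P P)"
proof -
  have w: "w j k > 0" if "k \<in> {1..N j}" for k
    using quad that unfolding needlet_quadrature_def by blast
  have quad_j: "(LINT z|sphere_measure. q z) = (\<Sum>k=1..N j. w j k * q (p j k))"
    if "polynomial_degree_le (2 ^ (j + 1) - 1) q" for q
    using quad that unfolding needlet_quadrature_def by blast
  have int: "integrable sphere_measure (\<lambda>y. f y * poly P (y \<bullet> p j k))" for k
    by (intro integrable_sphere_measure_mult f continuous_intros)
  have quad_P: "(\<Sum>k=1..N j. w j k * (poly P (x \<bullet> p j k) * poly P (y \<bullet> p j k))) = zonal_integral x y P P" for y
  proof -
    have "polynomial_degree_le (degree P + degree P) (\<lambda>z. poly P (x \<bullet> z) * poly P (y \<bullet> z))"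
      by (intro polynomial_degree_le_mult polynomial_degree_le_zonal) auto
    then have "polynomial_degree_le (2 ^ (j + 1) - 1) (\<lambda>z. poly P (x \<bullet> z) * poly P (y \<bullet> z))"
      by (rule polynomial_degree_le_mono) (use deg in auto)
    then show ?thesis
      unfolding zonal_integral_def by (rule quad_j[symmetric])
  qed
  have "(\<Sum>k=1..N j. sphere_inner f (needlet d h w p j k) * needlet d h w p j k x) =
      (\<Sum>k=1..N j. LINT y|sphere_measure. (w j k * poly P (x \<bullet> p j k)) * (f y * poly P (y \<bullet> p j k)))"
  proof (intro sum.cong refl)
    fix k assume "k \<in> {1..N j}"
    then have sqrt: "sqrt (w j k) * sqrt (w j k) = w j k"
      using w[of k] by simp
    let ?I = "LINT y|sphere_measure. f y * poly P (y \<bullet> p j k)"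
    have needlet: "needlet d h w p j k y = sqrt (w j k) * poly P (y \<bullet> p j k)" for y
      by (simp add: needlet_def kernel)
    have "sphere_inner f (needlet d h w p j k) = sqrt (w j k) * ?I"
      unfolding sphere_inner_def needlet mult.left_commute[of "f _"] by (rule integral_mult_right_zero)
    then have "sphere_inner f (needlet d h w p j k) * needlet d h w p j k x =
        (sqrt (w j k) * sqrt (w j k)) * poly P (x \<bullet> p j k) * ?I"
      unfolding needlet by (simp only: mult_ac)
    then show "sphere_inner f (needlet d h w p j k) * needlet d h w p j k x =
        (LINT y|sphere_measure. (w j k * poly P (x \<bullet> p j k)) * (f y * poly P (y \<bullet> p j k)))"
      unfolding sqrt by simp
  qed
  also have "\<dots> = (LINT y|sphere_measure. (\<Sum>k=1..N j. (w j k * poly P (x \<bullet> p j k)) * (f y * poly P (y \<bullet> p j k))))"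
    using int by (intro Bochner_Integration.integral_sum[symmetric]) simp
  also have "\<dots> = (LINT y|sphere_measure. f y * zonal_integral x y P P)"
    by (simp add: quad_P[symmetric] sum_distrib_left mult_ac)
  finally show ?thesis .
qed

lemma dyadic_scale: "real l / 2 powi (int j - 1) = 2 * real l / 2 ^ j"
  by (simp add: power_int_diff)

lemma needlet_kernel_eq_poly:
  assumes h: "needlet_filter h" and "j \<ge> 1"
  shows "filtered_kernel d (2 powi (int j - 1)) h t =
    poly (kernel_poly d (2 ^ j) (\<lambda>l. h (2 * real l / 2 ^ j))) t"
proof -
  have "(2::real) powi (int j - 1) \<ge> 1"
    using \<open>j \<ge> 1\<close> by (intro one_le_power_int) auto
  then show ?thesis
    unfolding dyadic_scale[symmetric]
    by (rule filtered_kernel_eq_poly) (auto simp: dyadic_scale field_simps intro!: needlet_filter_zero[OF h])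
qed

text \<open>Level 0, where the kernel is 1 by convention, also fits the polynomial formula. The
  telescoping step from level 0 to level 1 thus needs no separate treatment.\<close>

lemma filtered_kernel_H_eq_poly:
  assumes h: "needlet_filter h" and d: "d \<ge> 2" and n: "n \<ge> 2 ^ J"
  shows "filtered_kernel d (2 powi (int J - 1)) (filter_H h) t =
    poly (kernel_poly d n (\<lambda>l. filter_H h (2 * real l / 2 ^ J))) t"
proof (cases J)
  case 0
  \<comment> \<open>For \<open>l \<ge> 1\<close> the argument is at least 2, where \<open>h\<close>
    vanishes, so only the constant term survives.\<close>
  have "filter_H h (2 * real l) = (if l = 0 then 1 else 0)" for l
    using needlet_filter_zero[OF h, of "2 * real l"] by (simp add: filter_H_def)
  then show ?thesis
    using n 0 by (simp add: filtered_kernel_def kernel_poly_def poly_sum if_distrib[of "\<lambda>a. a * _"]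
        sum.delta gegenbauer_poly_0[OF d] harmonic_dim_0[OF d] cong: if_cong)
next
  case (Suc i)
  have "(2::real) powi (int J - 1) \<ge> 1"
    using Suc by (intro one_le_power_int) auto
  moreover have "filter_H h (real l / 2 powi (int J - 1)) = 0" if "l \<ge> n" for l
  proof -
    have "real (2 ^ J) \<le> real l"
      using n that by linarith
    then have "2 * real l / 2 ^ J \<ge> 2"
      by (simp add: field_simps)
    then show ?thesis
      using needlet_filter_zero[OF h, of "2 * real l / 2 ^ J"]
      by (simp add: dyadic_scale filter_H_def del: divide_less_eq_1_pos)
  qed
  ultimately show ?thesis
    unfolding dyadic_scale[symmetric] by (rule filtered_kernel_eq_poly)
qed

text \<open>This is \<open>filter_H_refine\<close> applied coefficientwise, with both kernels
  written at the common length \<open>2 ^ Suc J\<close>.\<close>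

lemma filtered_kernel_H_Suc:
  assumes h: "needlet_filter h" and d: "d \<ge> 2"
  shows "filtered_kernel d (2 powi (int (Suc J) - 1)) (filter_H h) t =
    filtered_kernel d (2 powi (int J - 1)) (filter_H h) t
    + poly (kernel_poly d (2 ^ Suc J) (\<lambda>l. (h (2 * real l / 2 ^ Suc J))\<^sup>2)) t"
proof -
  have "filter_H h (2 * real l / 2 ^ Suc J) = filter_H h (2 * real l / 2 ^ J) + (h (2 * real l / 2 ^ Suc J))\<^sup>2" for l
    using filter_H_refine[OF h, of "2 * real l / 2 ^ Suc J"] by simp
  then show ?thesis
    unfolding filtered_kernel_H_eq_poly[OF h d order_refl, of "Suc J"]
      filtered_kernel_H_eq_poly[OF h d power_increasing[of J "Suc J" 2], simplified]
    by (simp add: kernel_poly_def distrib_right smult_add_left sum.distrib)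
qed

theorem theorem3p10:
  fixes d J :: nat
    and h :: "real \<Rightarrow> real"
    and N :: "nat \<Rightarrow> nat"
    and w :: "nat \<Rightarrow> nat \<Rightarrow> real"
    and p :: "nat \<Rightarrow> nat \<Rightarrow> real^'n"
    and f :: "real^'n \<Rightarrow> real"
  assumes "d \<ge> 2" and "CARD('n) = d + 1"
    and "needlet_filter h"
    and "needlet_quadrature N w p"
    and "integrable sphere_measure f"
  shows "\<forall>x\<in>sphere 0 1.
    filtered_approx d (2 powi (int J - 1)) (filter_H h) f x =
      (\<Sum>j=0..J. \<Sum>k=1..N j.
         sphere_inner f (needlet d h w p j k) * needlet d h w p j k x) \<and>
    (\<Sum>j=0..J. \<Sum>k=1..N j.
         sphere_inner f (needlet d h w p j k) * needlet d h w p j k x) =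
      semidiscrete_needlet_approx d h N w p J f x"
proof (intro ballI conjI)
  fix x :: "real^'n"
  assume "x \<in> sphere 0 1"
  then have x: "norm x = 1" by simp
  have D: "DIM(real^'n) = d + 1"
    using assms(2) by simp
  note d = assms(1) and h = assms(3) and quad = assms(4) and f = assms(5)
  show "filtered_approx d (2 powi (int J - 1)) (filter_H h) f x =
      (\<Sum>j=0..J. \<Sum>k=1..N j. sphere_inner f (needlet d h w p j k) * needlet d h w p j k x)"
  proof (induction J)
    case 0
    \<comment> \<open>The scale is \<open>1/2 < 1\<close>, so the kernels of both filters are
      constant 1, and the level sum applies with the polynomial 1.\<close>
    have "filtered_kernel d (2 powi (int 0 - 1)) g t = poly 1 t" for g t
      by (simp add: filtered_kernel_def)
    then show ?case
      using needlet_level_sum[OF quad f, of d 0 h 1 x]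
      by (simp add: filtered_approx_def zonal_integral_def)
  next
    case (Suc J)
    let ?P = "kernel_poly d (2 ^ Suc J) (\<lambda>l. h (2 * real l / 2 ^ Suc J))"
    let ?Q = "kernel_poly d (2 ^ Suc J) (\<lambda>l. (h (2 * real l / 2 ^ Suc J))\<^sup>2)"
    have "degree ?P < 2 ^ Suc J"
      by (rule le_less_trans[OF degree_kernel_poly]) simp
    then have "(\<Sum>k=1..N (Suc J). sphere_inner f (needlet d h w p (Suc J) k) * needlet d h w p (Suc J) k x) =
        (LINT y|sphere_measure. f y * zonal_integral x y ?P ?P)"
      by (intro needlet_level_sum[OF quad f] needlet_kernel_eq_poly[OF h]) auto
    also have "\<dots> = (LINT y|sphere_measure. f y * poly ?Q (x \<bullet> y))"
      by (intro Bochner_Integration.integral_cong refl)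
         (simp add: space_sphere_measure kernel_poly_convolution[OF x _ D d])
    finally have level: "(\<Sum>k=1..N (Suc J). sphere_inner f (needlet d h w p (Suc J) k) * needlet d h w p (Suc J) k x) =
        (LINT y|sphere_measure. f y * poly ?Q (x \<bullet> y))" .
    \<comment> \<open>Integrability of both parts permits splitting the integral along
      \<open>filtered_kernel_H_Suc\<close>.\<close>
    have "integrable sphere_measure (\<lambda>y. f y * filtered_kernel d (2 powi (int J - 1)) (filter_H h) (x \<bullet> y))"
      unfolding filtered_kernel_H_eq_poly[OF h d order_refl]
      by (intro integrable_sphere_measure_mult f continuous_intros)
    moreover have "integrable sphere_measure (\<lambda>y. f y * poly ?Q (x \<bullet> y))"
      by (intro integrable_sphere_measure_mult f continuous_intros)
    ultimately have "filtered_approx d (2 powi (int (Suc J) - 1)) (filter_H h) f x =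
        filtered_approx d (2 powi (int J - 1)) (filter_H h) f x + (LINT y|sphere_measure. f y * poly ?Q (x \<bullet> y))"
      unfolding filtered_approx_def filtered_kernel_H_Suc[OF h d] distrib_left
      by (rule Bochner_Integration.integral_add)
    then show ?case
      unfolding sum.atLeast0_atMost_Suc level Suc.IH .
  qed
qed (simp add: semidiscrete_needlet_approx_def)

end
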